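(* Let $(X,\mu)$ be a Lebesgue space with $\mu(X)=1$ and let $M$ be a set of (summable) admissible semimetrics on $(X,\mu)$. Then $M$ is precompact in the m-norm if and only if the following two conditions hold: 1) (uniform integrability) the set $M$ is uniformly integrable on $(X\times X,\mu\times\mu)$; 2) (uniform admissibility) for every $\varepsilon>0$ there exists a partition of $X$ into finitely many measurable sets $X_1,\dots,X_k$ such that for every semimetric $\rho\in M$ there exists a measurable set $A\subset X$ of measure less than $\varepsilon$ such that $\mathrm{diam}_\rho(X_j\setminus A)<\varepsilon$ for $j=1,\dots,k$.
   Context: A Lebesgue space with $\mu(X)=1$ is a standard probability space. A semimetric on $X$ is a function $\rho:X\times X\to[0,\infty)$ with $\rho(x,x)=0$, $\rho(x,y)=\rho(y,x)$ and $\rho(x,z)\le\rho(x,y)+\rho(y,z)$. It is admissible if it is measurable on $(X\times X,\mu\times\mu)$ and there is $X_1\subset X$ of full measure such that $(X_1,\rho)$ is separable. Admissible semimetrics are assumed summable, i.e. in $L^1(X^2)=L^1(X\times X,\mu\times\mu)$. The m-norm of $f\in L^1(X^2)$ is $$\|f\|_m=\inf\{\|\rho\|_{L^1(X^2)}:\ \rho\text{ is a measurable summable semimetric},\ \rho(x,y)\ge|f(x,y)|\text{ for almost all }(x,y)\}\in[0,\infty]$$ ($\inf\emptyset=\infty$), and $\mathbb{M}=\{f\in L^1(X^2):\|f\|_m<\infty\}$ is the corresponding normed space. For a summable semimetric, $\|\rho\|_m=\|\rho\|_{L^1(X^2)}$. Precompact in the m-norm means having compact closure in $\mathbb{M}$.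 A family $K\subset L^1(\Omega,\nu)$ is uniformly integrable if $\lim_{R\to\infty}\sup_{f\in K}\int_{|f|>R}|f|\,d\nu=0$. *)

theory Defs
  imports "HOL-Probability.Probability"
begin

text \<open>
  Isomorphism modulo null sets: after discarding null sets on both sides there is a bimeasurable,
  measure-preserving bijection.
\<close>

definition iso_mod0 :: "'a measure \<Rightarrow> 'b measure \<Rightarrow> bool" where
  "iso_mod0 M N \<longleftrightarrow>
     (\<exists>A B \<phi>. A \<in> sets M \<and> emeasure M (space M - A) = 0 \<and>
              B \<in> sets N \<and> emeasure N (space N - B) = 0 \<and>
              bij_betw \<phi> A B \<and>
              \<phi> \<in> measurable (restrict_space M A) (restrict_space N B) \<and>
              inv_into A \<phi> \<in> measurable (restrict_space N B) (restrict_space M A) \<and>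
              (\<forall>S\<in>sets N. S \<subseteq> B \<longrightarrow> emeasure M (\<phi> -` S \<inter> A) = emeasure N S))"

text \<open>
  Lebesgue space of total mass one, in the sense of Rokhlin: a complete probability space that is,
  modulo null sets, the union of an interval carrying Lebesgue measure and at most countably many
  atoms.  Here \<open>C\<close> is the set of atoms; necessarily \<open>c = 1 - measure M C\<close>, and
  \<open>c = 0\<close> is the purely atomic case.
\<close>

definition lebesgue_prob_space :: "'a measure \<Rightarrow> bool" where
  "lebesgue_prob_space M \<longleftrightarrow>
     prob_space M \<and> complete_measure M \<and>
     (\<exists>C (c::real). C \<subseteq> space M \<and> countable C \<and> (\<forall>x\<in>C. {x} \<in> sets M) \<and> 0 \<le> c \<and>
        iso_mod0 (restrict_space M (space M - C)) (lebesgue_on {0..c}))"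

text \<open>
  The square of a Lebesgue space is again a Lebesgue space, so its product measure is completed.
\<close>

abbreviation square :: "'a measure \<Rightarrow> ('a \<times> 'a) measure" where
  "square \<mu> \<equiv> completion (\<mu> \<Otimes>\<^sub>M \<mu>)"

definition semimetric_on :: "'a set \<Rightarrow> ('a \<times> 'a \<Rightarrow> real) \<Rightarrow> bool" where
  "semimetric_on X \<rho> \<longleftrightarrow>
     (\<forall>x\<in>X. \<forall>y\<in>X. 0 \<le> \<rho> (x, y)) \<and>
     (\<forall>x\<in>X. \<rho> (x, x) = 0) \<and>
     (\<forall>x\<in>X. \<forall>y\<in>X. \<rho> (x, y) = \<rho> (y, x)) \<and>
     (\<forall>x\<in>X. \<forall>y\<in>X. \<forall>z\<in>X. \<rho> (x, z) \<le> \<rho> (x, y) + \<rho> (y, z))"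

definition semimetric_separable :: "'a set \<Rightarrow> ('a \<times> 'a \<Rightarrow> real) \<Rightarrow> bool" where
  "semimetric_separable X \<rho> \<longleftrightarrow>
     (\<exists>D\<subseteq>X. countable D \<and> (\<forall>x\<in>X. \<forall>\<epsilon>>0. \<exists>d\<in>D. \<rho> (x, d) < \<epsilon>))"

definition semimetric_diam :: "('a \<times> 'a \<Rightarrow> real) \<Rightarrow> 'a set \<Rightarrow> ennreal" where
  "semimetric_diam \<rho> S = (SUP z\<in>S \<times> S. ennreal (\<rho> z))"

definition summable_semimetric :: "'a measure \<Rightarrow> ('a \<times> 'a \<Rightarrow> real) \<Rightarrow> bool" where
  "summable_semimetric \<mu> \<rho> \<longleftrightarrow> semimetric_on (space \<mu>) \<rho> \<and> integrable (square \<mu>) \<rho>"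

definition admissible_semimetric :: "'a measure \<Rightarrow> ('a \<times> 'a \<Rightarrow> real) \<Rightarrow> bool" where
  "admissible_semimetric \<mu> \<rho> \<longleftrightarrow>
     summable_semimetric \<mu> \<rho> \<and>
     (\<exists>X\<^sub>1\<in>sets \<mu>. emeasure \<mu> (space \<mu> - X\<^sub>1) = 0 \<and> semimetric_separable X\<^sub>1 \<rho>)"

text \<open>The m-norm; the infimum of the empty set is \<open>\<infinity>\<close> in \<^typ>\<open>ennreal\<close>.\<close>

definition m_norm :: "'a measure \<Rightarrow> ('a \<times> 'a \<Rightarrow> real) \<Rightarrow> ennreal" where
  "m_norm \<mu> f =
     (INF \<rho> \<in> {\<rho>. summable_semimetric \<mu> \<rho> \<and> (AE z in square \<mu>. \<bar>f z\<bar> \<le> \<rho> z)}.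
        \<integral>\<^sup>+ z. ennreal \<bar>\<rho> z\<bar> \<partial>square \<mu>)"

text \<open>
  The space of integrable functions of finite m-norm modulo almost everywhere equality.  Its
  elements are equivalence classes; the metric induced by the m-norm is computed on
  representatives.  That it does not depend on their choice, and that it is a metric, is
  shown below.
\<close>

definition ae_rel :: "'b measure \<Rightarrow> (('b \<Rightarrow> real) \<times> ('b \<Rightarrow> real)) set" where
  "ae_rel N = {(f, g). integrable N f \<and> integrable N g \<and> (AE z in N. f z = g z)}"

definition L1_class :: "'b measure \<Rightarrow> ('b \<Rightarrow> real) \<Rightarrow> ('b \<Rightarrow> real) set" where
  "L1_class N f = ae_rel N `` {f}"

definition m_space :: "'a measure \<Rightarrow> ('a \<times> 'a \<Rightarrow> real) set set" where
  "m_space \<mu> = L1_class (square \<mu>) ` {f. integrable (square \<mu>) f \<and> m_norm \<mu> f < \<infinity>}"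

definition m_dist ::
    "'a measure \<Rightarrow> ('a \<times> 'a \<Rightarrow> real) set \<Rightarrow> ('a \<times> 'a \<Rightarrow> real) set \<Rightarrow> real" where
  "m_dist \<mu> F G = enn2real (m_norm \<mu> (\<lambda>z. (SOME f. f \<in> F) z - (SOME g. g \<in> G) z))"

abbreviation m_topology :: "'a measure \<Rightarrow> ('a \<times> 'a \<Rightarrow> real) set topology" where
  "m_topology \<mu> \<equiv> Metric_space.mtopology (m_space \<mu>) (m_dist \<mu>)"

definition m_precompact :: "'a measure \<Rightarrow> ('a \<times> 'a \<Rightarrow> real) set \<Rightarrow> bool" where
  "m_precompact \<mu> K \<longleftrightarrow>
     compactin (m_topology \<mu>) (m_topology \<mu> closure_of (L1_class (square \<mu>) ` K))"

definition uniformly_integrable :: "'b measure \<Rightarrow> ('b \<Rightarrow> real) set \<Rightarrow> bool" where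
  "uniformly_integrable N K \<longleftrightarrow>
     ((\<lambda>R::real. SUP f\<in>K. \<integral>\<^sup>+ z. ennreal \<bar>f z\<bar> * indicator {z. R < \<bar>f z\<bar>} z \<partial>N) \<longlongrightarrow> 0) at_top"

definition uniformly_admissible :: "'a measure \<Rightarrow> ('a \<times> 'a \<Rightarrow> real) set \<Rightarrow> bool" where
  "uniformly_admissible \<mu> K \<longleftrightarrow>
     (\<forall>\<epsilon>::real. \<epsilon> > 0 \<longrightarrow>
        (\<exists>P. finite P \<and> partition_on (space \<mu>) P \<and> P \<subseteq> sets \<mu> \<and>
           (\<forall>\<rho>\<in>K. \<exists>A\<in>sets \<mu>. measure \<mu> A < \<epsilon> \<and>
              (\<forall>Y\<in>P. semimetric_diam \<rho> (Y - A) < ennreal \<epsilon>))))"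


lemma L1_class_self: "integrable N f \<Longrightarrow> f \<in> L1_class N f"
  by (simp add: L1_class_def ae_rel_def)

lemma L1_class_eq_iff:
  assumes "integrable N f" "integrable N g"
  shows "L1_class N f = L1_class N g \<longleftrightarrow> (AE z in N. f z = g z)"
proof
  assume "L1_class N f = L1_class N g"
  then have "g \<in> L1_class N f" using assms L1_class_self by blast
  then show "AE z in N. f z = g z" by (simp add: L1_class_def ae_rel_def)
next
  assume *: "AE z in N. f z = g z"
  have "(AE z in N. f z = h z) \<longleftrightarrow> (AE z in N. g z = h z)" for h
  proof
    show "AE z in N. g z = h z" if "AE z in N. f z = h z"
      using that * by eventually_elim simp
    show "AE z in N. f z = h z" if "AE z in N. g z = h z"
      using that * by eventually_elim simp
  qed
  then show "L1_class N f = L1_class N g"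
    using assms by (auto simp: L1_class_def ae_rel_def)
qed

lemma L1_class_AE: "g \<in> L1_class N f \<Longrightarrow> AE z in N. f z = g z"
  by (simp add: L1_class_def ae_rel_def)

lemma SOME_L1_class:
  assumes "integrable N f"
  shows "AE z in N. f z = (SOME g. g \<in> L1_class N f) z"
proof -
  have "(SOME g. g \<in> L1_class N f) \<in> L1_class N f"
    using L1_class_self[OF assms] by (rule someI[where P = "\<lambda>g. g \<in> L1_class N f"])
  then show ?thesis by (rule L1_class_AE)
qed

lemma m_norm_cong_AE:
  assumes "AE z in square \<mu>. \<bar>f z\<bar> = \<bar>g z\<bar>"
  shows "m_norm \<mu> f = m_norm \<mu> g"
proof -
  have "(AE z in square \<mu>. \<bar>f z\<bar> \<le> \<rho> z) \<longleftrightarrow> (AE z in square \<mu>. \<bar>g z\<bar> \<le> \<rho> z)" for \<rho>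
  proof
    show "AE z in square \<mu>. \<bar>g z\<bar> \<le> \<rho> z" if "AE z in square \<mu>. \<bar>f z\<bar> \<le> \<rho> z"
      using that assms by eventually_elim simp
    show "AE z in square \<mu>. \<bar>f z\<bar> \<le> \<rho> z" if "AE z in square \<mu>. \<bar>g z\<bar> \<le> \<rho> z"
      using that assms by eventually_elim simp
  qed
  then show ?thesis by (simp add: m_norm_def)
qed

lemma m_dist_L1_class:
  assumes "integrable (square \<mu>) f" "integrable (square \<mu>) g"
  shows "m_dist \<mu> (L1_class (square \<mu>) f) (L1_class (square \<mu>) g)
           = enn2real (m_norm \<mu> (\<lambda>z. f z - g z))"
  unfolding m_dist_def
proof (intro arg_cong[where f = enn2real] m_norm_cong_AE)
  show "AE z in square \<mu>. \<bar>(SOME h. h \<in> L1_class (square \<mu>) f) z -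
      (SOME h. h \<in> L1_class (square \<mu>) g) z\<bar> = \<bar>f z - g z\<bar>"
    using SOME_L1_class[OF assms(1)] SOME_L1_class[OF assms(2)] by eventually_elim presburger
qed

lemma m_norm_add:
  "m_norm \<mu> (\<lambda>z. f z + g z) \<le> m_norm \<mu> f + m_norm \<mu> g"
proof (rule ennreal_le_epsilon)
  fix e :: real assume e: "0 < e" and fin: "m_norm \<mu> f + m_norm \<mu> g < top"
  let ?S = "\<lambda>f. {\<rho>. summable_semimetric \<mu> \<rho> \<and> (AE z in square \<mu>. \<bar>f z\<bar> \<le> \<rho> z)}"
  let ?I = "\<lambda>\<rho>. \<integral>\<^sup>+ z. ennreal \<bar>\<rho> z\<bar> \<partial>square \<mu>"
  have *: "\<exists>\<rho>\<in>?S h. ?I \<rho> < m_norm \<mu> h + ennreal (e/2)" if "m_norm \<mu> h < top" for h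
  proof -
    have "m_norm \<mu> h < m_norm \<mu> h + ennreal (e/2)"
      using that e by (simp add: ennreal_add_left_cancel_less)
    then show ?thesis
      unfolding m_norm_def INF_less_iff by blast
  qed
  from fin have "m_norm \<mu> f < top" "m_norm \<mu> g < top" by auto
  then obtain r s where r: "r \<in> ?S f" "?I r < m_norm \<mu> f + ennreal (e/2)"
    and s: "s \<in> ?S g" "?I s < m_norm \<mu> g + ennreal (e/2)"
    using * by meson
  let ?t = "\<lambda>z. r z + s z"
  have "semimetric_on (space \<mu>) ?t"
    using r(1) s(1) unfolding summable_semimetric_def semimetric_on_def
    by (auto intro: add_mono simp: algebra_simps) (smt (verit))+
  moreover have "integrable (square \<mu>) ?t"
    using r(1) s(1) by (auto simp: summable_semimetric_def)
  moreover have "AE z in square \<mu>. \<bar>f z + g z\<bar> \<le> ?t z"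
  proof -
    have "AE z in square \<mu>. \<bar>f z\<bar> \<le> r z" "AE z in square \<mu>. \<bar>g z\<bar> \<le> s z"
      using r(1) s(1) by auto
    then show ?thesis by eventually_elim simp
  qed
  ultimately have "m_norm \<mu> (\<lambda>z. f z + g z) \<le> ?I ?t"
    unfolding m_norm_def by (intro INF_lower) (auto simp: summable_semimetric_def)
  also have "\<dots> \<le> (\<integral>\<^sup>+ z. ennreal \<bar>r z\<bar> + ennreal \<bar>s z\<bar> \<partial>square \<mu>)"
    by (intro nn_integral_mono) (auto simp flip: ennreal_plus intro!: ennreal_leI)
  also have "\<dots> = ?I r + ?I s"
    using r(1) s(1) 
    by (intro nn_integral_add) (auto simp: summable_semimetric_def)
  also have "\<dots> \<le> (m_norm \<mu> f + ennreal (e/2)) + (m_norm \<mu> g + ennreal (e/2))"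
    using r(2) s(2) by (intro add_mono) auto
  also have "\<dots> = m_norm \<mu> f + m_norm \<mu> g + (ennreal (e/2) + ennreal (e/2))"
    by (simp add: ac_simps)
  also have "ennreal (e/2) + ennreal (e/2) = ennreal e"
    using e by (simp flip: ennreal_plus)
  finally show "m_norm \<mu> (\<lambda>z. f z + g z) \<le> m_norm \<mu> f + m_norm \<mu> g + ennreal e" .
qed

lemma m_norm_uminus: "m_norm \<mu> (\<lambda>z. - f z) = m_norm \<mu> f"
  by (rule m_norm_cong_AE) simp

lemma m_norm_diff_commute: "m_norm \<mu> (\<lambda>z. f z - g z) = m_norm \<mu> (\<lambda>z. g z - f z)"
  by (rule m_norm_cong_AE) (simp add: abs_minus_commute)

lemma m_norm_diff_finite:
  assumes "m_norm \<mu> f < \<infinity>" "m_norm \<mu> g < \<infinity>"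
  shows "m_norm \<mu> (\<lambda>z. f z - g z) < \<infinity>"
  using m_norm_add[of \<mu> f "\<lambda>z. - g z"] m_norm_uminus[of \<mu> g] assms
  by (auto simp: order.strict_trans1)

lemma L1_norm_le_m_norm: "(\<integral>\<^sup>+ z. ennreal \<bar>f z\<bar> \<partial>square \<mu>) \<le> m_norm \<mu> f"
  unfolding m_norm_def
proof (intro INF_greatest nn_integral_mono_AE)
  fix \<rho> assume "\<rho> \<in> {\<rho>. summable_semimetric \<mu> \<rho> \<and> (AE z in square \<mu>. \<bar>f z\<bar> \<le> \<rho> z)}"
  then have "AE z in square \<mu>. \<bar>f z\<bar> \<le> \<rho> z" by simp
  then show "AE z in square \<mu>. ennreal \<bar>f z\<bar> \<le> ennreal \<bar>\<rho> z\<bar>"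
    by eventually_elim (auto intro!: ennreal_leI)
qed

lemma m_norm_eq_0_iff:
  assumes "integrable (square \<mu>) f"
  shows "m_norm \<mu> f = 0 \<longleftrightarrow> (AE z in square \<mu>. f z = 0)"
proof
  assume "m_norm \<mu> f = 0"
  then have "(\<integral>\<^sup>+ z. ennreal \<bar>f z\<bar> \<partial>square \<mu>) = 0"
    using L1_norm_le_m_norm[of \<mu> f] by simp
  then have "AE z in square \<mu>. ennreal \<bar>f z\<bar> = 0"
    using assms by (subst (asm) nn_integral_0_iff_AE) auto
  then show "AE z in square \<mu>. f z = 0"
    by eventually_elim simp
next
  assume "AE z in square \<mu>. f z = 0"
  then have "AE z in square \<mu>. \<bar>f z\<bar> \<le> (\<lambda>_. 0) z" by eventually_elim simp
  then have "m_norm \<mu> f \<le> (\<integral>\<^sup>+ z. ennreal \<bar>0\<bar> \<partial>square \<mu>)"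
    unfolding m_norm_def
    by (intro INF_lower2[of "\<lambda>_. 0"]) (auto simp: summable_semimetric_def semimetric_on_def)
  then show "m_norm \<mu> f = 0" by simp
qed

lemma m_norm_summable_semimetric:
  assumes "summable_semimetric \<mu> \<rho>"
  shows "m_norm \<mu> \<rho> = (\<integral>\<^sup>+ z. ennreal \<bar>\<rho> z\<bar> \<partial>square \<mu>)"
proof (rule antisym)
  have "AE z in square \<mu>. \<bar>\<rho> z\<bar> \<le> \<rho> z"
    by (rule AE_I2)
      (use assms in \<open>auto simp: summable_semimetric_def semimetric_on_def space_pair_measure\<close>)
  then show "m_norm \<mu> \<rho> \<le> (\<integral>\<^sup>+ z. ennreal \<bar>\<rho> z\<bar> \<partial>square \<mu>)"
    unfolding m_norm_def using assms by (intro INF_lower) simp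
qed (rule L1_norm_le_m_norm)

lemma L1_class_in_m_space:
  assumes "summable_semimetric \<mu> \<rho>"
  shows "L1_class (square \<mu>) \<rho> \<in> m_space \<mu>"
proof -
  have "integrable (square \<mu>) \<rho>" using assms by (simp add: summable_semimetric_def)
  then show ?thesis
    unfolding m_space_def using m_norm_summable_semimetric[OF assms]
    by (auto simp: integrable_iff_bounded)
qed

lemma Metric_space_m_space: "Metric_space (m_space \<mu>) (m_dist \<mu>)"
proof
  show "0 \<le> m_dist \<mu> F G" for F G by (simp add: m_dist_def)
  show "m_dist \<mu> F G = m_dist \<mu> G F" for F G
    unfolding m_dist_def by (subst m_norm_diff_commute) rule
next
  fix F G assume "F \<in> m_space \<mu>" "G \<in> m_space \<mu>"
  then obtain f g where f: "integrable (square \<mu>) f" "m_norm \<mu> f < \<infinity>" "F = L1_class (square \<mu>) f"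
    and g: "integrable (square \<mu>) g" "m_norm \<mu> g < \<infinity>" "G = L1_class (square \<mu>) g"
    by (auto simp: m_space_def)
  have "m_dist \<mu> F G = 0 \<longleftrightarrow> m_norm \<mu> (\<lambda>z. f z - g z) = 0"
    using m_norm_diff_finite[OF f(2) g(2)] f g
    by (auto simp: m_dist_L1_class enn2real_eq_0_iff)
  also have "\<dots> \<longleftrightarrow> F = G"
    using f g by (simp add: m_norm_eq_0_iff L1_class_eq_iff)
  finally show "m_dist \<mu> F G = 0 \<longleftrightarrow> F = G" .
next
  fix F G H assume "F \<in> m_space \<mu>" "G \<in> m_space \<mu>" "H \<in> m_space \<mu>"
  then obtain f g h where f: "integrable (square \<mu>) f" "m_norm \<mu> f < \<infinity>" "F = L1_class (square \<mu>) f"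
    and g: "integrable (square \<mu>) g" "m_norm \<mu> g < \<infinity>" "G = L1_class (square \<mu>) g"
    and h: "integrable (square \<mu>) h" "m_norm \<mu> h < \<infinity>" "H = L1_class (square \<mu>) h"
    by (auto simp: m_space_def)
  have "m_norm \<mu> (\<lambda>z. f z - h z) \<le> m_norm \<mu> (\<lambda>z. f z - g z) + m_norm \<mu> (\<lambda>z. g z - h z)"
    using m_norm_add[of \<mu> "\<lambda>z. f z - g z" "\<lambda>z. g z - h z"] by simp
  then have "enn2real (m_norm \<mu> (\<lambda>z. f z - h z))
      \<le> enn2real (m_norm \<mu> (\<lambda>z. f z - g z) + m_norm \<mu> (\<lambda>z. g z - h z))"
    using m_norm_diff_finite[OF f(2) g(2)] m_norm_diff_finite[OF g(2) h(2)]
    by (intro enn2real_mono) auto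
  also have "\<dots> = enn2real (m_norm \<mu> (\<lambda>z. f z - g z)) + enn2real (m_norm \<mu> (\<lambda>z. g z - h z))"
    using m_norm_diff_finite[OF f(2) g(2)] m_norm_diff_finite[OF g(2) h(2)]
    by (intro enn2real_plus) auto
  finally show "m_dist \<mu> F H \<le> m_dist \<mu> F G + m_dist \<mu> G H"
    using f g h by (simp add: m_dist_L1_class)
qed

end

(*
  The space of functions of finite m-norm is complete: a rapidly Cauchy sequence is dominated by a
  sum of semimetrics, which is again a semimetric.  Hence M is precompact iff it has finite
  epsilon-nets for the m-norm.

  If it has, uniform integrability passes from a finite net to M because the m-norm dominates the
  L1-norm.  Uniform admissibility passes to M as well: finitely many admissible semimetrics admit a
  common partition into small cells, and a semimetric of small integral is uniformly small outside
  a set of small measure, by comparison with a typical base point.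

  Conversely, uniform integrability bounds all rho in M uniformly off small sets A, so only finitely
  many rounded matrices of distances between representatives of the cells occur.  Two semimetrics
  with the same matrix differ by a small constant off a small set E.  On E they are compared with
  their distances to a typical point p outside E, and h(x) + h(y) + c with
  h(x) = 1_E(x) (rho(x, p) + sigma(x, p)) is a semimetric off the diagonal that dominates
  |rho - sigma| and has small integral.
*)
theory Submission
  imports Defs
begin

section \<open>Sections, null sets and Tonelli's theorem in the completed square\<close>

locale complete_prob_space = prob_space \<mu> + complete_measure \<mu> for \<mu> :: "'a measure"
begin

sublocale square: pair_prob_space \<mu> \<mu> ..

lemma measurable_fst_square [measurable]: "fst \<in> square \<mu> \<rightarrow>\<^sub>M \<mu>"
  and measurable_snd_square [measurable]: "snd \<in> square \<mu> \<rightarrow>\<^sub>M \<mu>"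
  by (auto intro: measurable_completion)

lemma emeasure_square_space: "emeasure (square \<mu>) (space (square \<mu>)) = 1"
  using square.P.emeasure_space_1 by simp

lemma AE_square_D: "AE z in square \<mu>. P z \<Longrightarrow> AE x in \<mu>. AE y in \<mu>. P (x, y)"
  by (rule square.AE_pair) (simp add: AE_completion_iff)

lemma AE_square_fst: "AE x in \<mu>. P x \<Longrightarrow> AE z in square \<mu>. P (fst z)"
  and AE_square_snd: "AE x in \<mu>. P x \<Longrightarrow> AE z in square \<mu>. P (snd z)"
proof -
  assume "AE x in \<mu>. P x"
  then obtain N where N: "{x \<in> space \<mu>. \<not> P x} \<subseteq> N" "emeasure \<mu> N = 0" "N \<in> sets \<mu>"
    by (rule AE_E)
  have "AE z in \<mu> \<Otimes>\<^sub>M \<mu>. P (fst z)"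
    by (rule AE_I[of _ _ "N \<times> space \<mu>"])
      (use N in \<open>auto simp: space_pair_measure emeasure_pair_measure_Times\<close>)
  then show "AE z in square \<mu>. P (fst z)" by (rule AE_completion)
  have "AE z in \<mu> \<Otimes>\<^sub>M \<mu>. P (snd z)"
    by (rule AE_I[of _ _ "space \<mu> \<times> N"])
      (use N in \<open>auto simp: space_pair_measure emeasure_pair_measure_Times\<close>)
  then show "AE z in square \<mu>. P (snd z)" by (rule AE_completion)
qed

end

text \<open>Preimages under the two functions differ by a subset of a null set, and completeness
  makes such subsets measurable. This is what permits changes on null sets further on.\<close>

lemma (in complete_measure) borel_measurable_AE_eq:
  fixes f g :: "'a \<Rightarrow> 'b::topological_space"
  assumes f: "f \<in> borel_measurable M" and eq: "AE x in M. f x = g x"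
  shows "g \<in> borel_measurable M"
proof (rule measurableI)
  fix B :: "'b set" assume B: "B \<in> sets borel"
  have "AE x in M. x \<in> f -` B \<inter> space M \<longleftrightarrow> x \<in> g -` B \<inter> space M"
    using eq by eventually_elim auto
  then show "g -` B \<inter> space M \<in> sets M"
    by (rule in_sets_AE) (use f B in \<open>auto intro: measurable_sets\<close>)
qed simp

context complete_prob_space
begin

text \<open>A function measurable for the completed square agrees almost everywhere with one
  measurable for the product, all of whose sections are measurable. For almost every
  \<open>x\<close> the two sections agree almost everywhere, and completeness of
  \<open>\<mu>\<close> transfers measurability.\<close>

lemma borel_measurable_section:
  fixes f :: "'a \<times> 'a \<Rightarrow> real"
  assumes "f \<in> borel_measurable (square \<mu>)"
  shows "AE x in \<mu>. (\<lambda>y. f (x, y)) \<in> borel_measurable \<mu>"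
proof -
  obtain g where g [measurable]: "g \<in> borel_measurable (\<mu> \<Otimes>\<^sub>M \<mu>)" and eq: "AE z in \<mu> \<Otimes>\<^sub>M \<mu>. f z = g z"
    using completion_ex_borel_measurable_real[OF assms] by blast
  have "AE x in \<mu>. AE y in \<mu>. g (x, y) = f (x, y)"
    using square.AE_pair[OF eq] by (simp add: eq_commute)
  then show ?thesis
    using AE_space
  proof eventually_elim
    case (elim x)
    have "(\<lambda>y. g (x, y)) \<in> borel_measurable \<mu>" using elim by measurable
    then show ?case using elim(1) by (rule borel_measurable_AE_eq)
  qed
qed

text \<open>Tonelli's theorem survives the completion: replacing \<open>f\<close> by a
  product-measurable function equal to it almost everywhere alters the inner integral only for a
  null set of \<open>x\<close>.\<close>

lemma nn_integral_square:
  assumes "f \<in> borel_measurable (square \<mu>)"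
  shows "(\<integral>\<^sup>+ x. \<integral>\<^sup>+ y. f (x, y) \<partial>\<mu> \<partial>\<mu>) = (\<integral>\<^sup>+ z. f z \<partial>square \<mu>)"
proof -
  obtain g where g [measurable]: "g \<in> borel_measurable (\<mu> \<Otimes>\<^sub>M \<mu>)" and eq: "AE z in \<mu> \<Otimes>\<^sub>M \<mu>. f z = g z"
    using completion_ex_borel_measurable[OF assms] by blast
  have "AE x in \<mu>. (\<integral>\<^sup>+ y. f (x, y) \<partial>\<mu>) = (\<integral>\<^sup>+ y. g (x, y) \<partial>\<mu>)"
    using square.AE_pair[OF eq] by eventually_elim (rule nn_integral_cong_AE)
  then have "(\<integral>\<^sup>+ x. \<integral>\<^sup>+ y. f (x, y) \<partial>\<mu> \<partial>\<mu>) = (\<integral>\<^sup>+ x. \<integral>\<^sup>+ y. g (x, y) \<partial>\<mu> \<partial>\<mu>)"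
    by (rule nn_integral_cong_AE)
  also have "\<dots> = (\<integral>\<^sup>+ z. g z \<partial>(\<mu> \<Otimes>\<^sub>M \<mu>))"
    by (rule nn_integral_fst[OF g])
  also have "\<dots> = (\<integral>\<^sup>+ z. f z \<partial>(\<mu> \<Otimes>\<^sub>M \<mu>))"
    using eq by (intro nn_integral_cong_AE) (auto simp: eq_commute)
  finally show ?thesis by (simp add: nn_integral_completion)
qed

lemma nn_integral_square_fst:
  assumes [measurable]: "f \<in> borel_measurable \<mu>"
  shows "(\<integral>\<^sup>+ z. f (fst z) \<partial>square \<mu>) = (\<integral>\<^sup>+ x. f x \<partial>\<mu>)"
  by (subst nn_integral_square[symmetric]) (simp_all add: emeasure_space_1)

lemma nn_integral_square_snd:
  assumes [measurable]: "f \<in> borel_measurable \<mu>"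
  shows "(\<integral>\<^sup>+ z. f (snd z) \<partial>square \<mu>) = (\<integral>\<^sup>+ x. f x \<partial>\<mu>)"
  by (subst nn_integral_square[symmetric]) (simp_all add: emeasure_space_1)

section \<open>Typical base points and a Markov bound for semimetrics\<close>

text \<open>An average below \<open>c\<close> over \<open>G\<close> forces a value below
  \<open>c\<close> at some generic point. In the applications \<open>Q\<close> carries the
  measurability of the section through that point, so one choice secures both.\<close>

lemma ex_AE_less_average:
  assumes Q: "AE x in \<mu>. Q x" and G: "G \<in> sets \<mu>"
    and less: "(\<integral>\<^sup>+ x. g x * indicator G x \<partial>\<mu>) < c * emeasure \<mu> G"
  shows "\<exists>x\<in>G. Q x \<and> g x < c"
proof (rule ccontr)
  assume *: "\<not> ?thesis"
  have "AE x in \<mu>. c * indicator G x \<le> g x * indicator G x"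
    using Q by eventually_elim (use * in \<open>auto simp: indicator_def not_less\<close>)
  then have "(\<integral>\<^sup>+ x. c * indicator G x \<partial>\<mu>) \<le> (\<integral>\<^sup>+ x. g x * indicator G x \<partial>\<mu>)"
    by (rule nn_integral_mono_AE)
  with less G show False by (simp add: nn_integral_cmult_indicator)
qed

lemma ex_AE_less:
  assumes "AE x in \<mu>. Q x" "(\<integral>\<^sup>+ x. g x \<partial>\<mu>) < c"
  shows "\<exists>x\<in>space \<mu>. Q x \<and> g x < c"
proof (rule ex_AE_less_average)
  show "AE x in \<mu>. Q x" by fact
  have "(\<integral>\<^sup>+ x. g x * indicator (space \<mu>) x \<partial>\<mu>) = (\<integral>\<^sup>+ x. g x \<partial>\<mu>)"
    by (intro nn_integral_cong) auto
  then show "(\<integral>\<^sup>+ x. g x * indicator (space \<mu>) x \<partial>\<mu>) < c * emeasure \<mu> (space \<mu>)"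
    using assms(2) by (simp add: emeasure_space_1)
qed simp

text \<open>Some base point has mean distance below \<open>C\<close> to the other points. By
  Markov's inequality only a set of measure at most \<open>C / R\<close> lies at distance
  \<open>R\<close> or more from it, and off that set the triangle inequality through the base point
  gives the bound.\<close>

lemma semimetric_bounded_off:
  assumes \<sigma>: "semimetric_on (space \<mu>) \<sigma>" and meas: "\<sigma> \<in> borel_measurable (square \<mu>)"
    and int: "(\<integral>\<^sup>+ z. ennreal (\<sigma> z) \<partial>square \<mu>) < ennreal C" and R: "0 < R"
  shows "\<exists>A\<in>sets \<mu>. measure \<mu> A \<le> C / R \<and>
           (\<forall>x\<in>space \<mu> - A. \<forall>y\<in>space \<mu> - A. \<sigma> (x, y) \<le> 2 * R)"
proof -
  have C: "0 < C" using int by (metis ennreal_less_zero_iff not_less_zero order.strict_trans1 zero_le)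
  have "(\<integral>\<^sup>+ x. \<integral>\<^sup>+ y. ennreal (\<sigma> (x, y)) \<partial>\<mu> \<partial>\<mu>) < ennreal C"
    using int meas by (subst nn_integral_square) auto
  from ex_AE_less[OF borel_measurable_section[OF meas] this]
  obtain x where x: "x \<in> space \<mu>" "(\<integral>\<^sup>+ y. ennreal (\<sigma> (x, y)) \<partial>\<mu>) < ennreal C"
    and [measurable]: "(\<lambda>y. \<sigma> (x, y)) \<in> borel_measurable \<mu>" by blast
  \<comment> \<open>The set has the shape that Markov's inequality expects; \<open>A\<close>
    rewrites it as a level set of the distance from \<open>x\<close>.\<close>
  let ?A = "{y\<in>space \<mu>. 1 \<le> ennreal (1 / R) * ennreal (\<sigma> (x, y))}"
  have A: "?A = {y\<in>space \<mu>. R \<le> \<sigma> (x, y)}"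
  proof (intro Collect_cong conj_cong refl)
    fix y assume y: "y \<in> space \<mu>"
    then have "0 \<le> \<sigma> (x, y)" using \<sigma> x by (auto simp: semimetric_on_def)
    then show "(1 \<le> ennreal (1 / R) * ennreal (\<sigma> (x, y))) = (R \<le> \<sigma> (x, y))"
      using R by (simp flip: ennreal_mult ennreal_1 add: field_simps del: ennreal_1)
  qed
  have "emeasure \<mu> ?A \<le> ennreal (1 / R) * (\<integral>\<^sup>+ y. ennreal (\<sigma> (x, y)) * indicator (space \<mu>) y \<partial>\<mu>)"
    by (rule nn_integral_Markov_inequality) auto
  also have "(\<integral>\<^sup>+ y. ennreal (\<sigma> (x, y)) * indicator (space \<mu>) y \<partial>\<mu>) = (\<integral>\<^sup>+ y. ennreal (\<sigma> (x, y)) \<partial>\<mu>)"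
    by (intro nn_integral_cong) auto
  also have "ennreal (1 / R) * \<dots> \<le> ennreal (1 / R) * ennreal C"
    using x by (intro mult_left_mono) auto
  also have "\<dots> = ennreal (C / R)"
    using R C by (simp flip: ennreal_mult)
  finally have "measure \<mu> ?A \<le> C / R"
    using R C by (simp add: emeasure_eq_measure)
  moreover have "\<sigma> (y, z) \<le> 2 * R" if "y \<in> space \<mu> - ?A" "z \<in> space \<mu> - ?A" for y z
  proof -
    have "\<sigma> (y, z) \<le> \<sigma> (y, x) + \<sigma> (x, z)" "\<sigma> (y, x) = \<sigma> (x, y)"
      using \<sigma> x that unfolding semimetric_on_def by blast+
    then show ?thesis using that unfolding A by auto
  qed
  ultimately show ?thesis by (intro bexI[of _ ?A]) auto
qed

end

section \<open>Measurability of the diagonal\<close>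

lemma borel_measurable_lebesgue_ident: "(\<lambda>x. x) \<in> borel_measurable lebesgue"
  by (rule measurable_completion) simp

text \<open>Off the atoms and a null set, points are separated by one measurable real function. The
  diagonal is therefore a coincidence set of that function, together with countably many atomic
  points and a piece inside a null square.\<close>

lemma measurable_diagonal_square:
  assumes "lebesgue_prob_space \<mu>"
  shows "{z \<in> space \<mu> \<times> space \<mu>. fst z = snd z} \<in> sets (square \<mu>)"
proof -
  from assms interpret complete_prob_space \<mu>
    by (simp add: lebesgue_prob_space_def complete_prob_space_def)
  from assms obtain C and c :: real where C: "C \<subseteq> space \<mu>" "countable C" "\<And>x. x \<in> C \<Longrightarrow> {x} \<in> sets \<mu>"
    and iso: "iso_mod0 (restrict_space \<mu> (space \<mu> - C)) (lebesgue_on {0..c})"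
    unfolding lebesgue_prob_space_def by blast
  from iso obtain A B \<phi> where A: "A \<in> sets (restrict_space \<mu> (space \<mu> - C))"
    and null: "emeasure (restrict_space \<mu> (space \<mu> - C)) (space (restrict_space \<mu> (space \<mu> - C)) - A) = 0"
    and bij: "bij_betw \<phi> A B"
    and \<phi>: "\<phi> \<in> measurable (restrict_space (restrict_space \<mu> (space \<mu> - C)) A)
                 (restrict_space (lebesgue_on {0..c}) B)"
    unfolding iso_mod0_def by (elim exE conjE) (rule that)
  have C_sets [measurable]: "C \<in> sets \<mu>"
    using sets.countable_UN''[OF C(2), of "\<lambda>x. {x}" \<mu>] C(3) by simp
  have A_sets [measurable]: "A \<in> sets \<mu>" and AC: "A \<subseteq> space \<mu> - C"
    using A by (auto simp: sets_restrict_space_iff sets.Int_space_eq2)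
  have N0: "emeasure \<mu> (space \<mu> - C - A) = 0"
    using null by (simp add: emeasure_restrict_space space_restrict_space Int_absorb2 sets.Int_space_eq2)
  have "\<phi> \<in> measurable (restrict_space \<mu> A) (restrict_space (lebesgue_on {0..c}) B)"
    using \<phi> AC by (simp add: restrict_restrict_space Int_absorb1 Int_absorb2)
  then have "\<phi> \<in> measurable (restrict_space \<mu> A) lebesgue"
    by (simp add: measurable_restrict_space2_iff)
  from measurable_compose[OF this borel_measurable_lebesgue_ident]
  have "\<phi> \<in> borel_measurable (restrict_space \<mu> A)" .
  \<comment> \<open>The map is controlled only on \<open>A\<close>; it is extended by zero. Its
    injectivity still refers to \<open>A\<close> alone, so the coincidence set below has to require
    both coordinates to lie in \<open>A\<close>.\<close>
  then have \<phi>_meas: "(\<lambda>x. \<phi> x * indicator A x) \<in> borel_measurable \<mu>"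
    by (subst (asm) borel_measurable_restrict_space_iff) (auto simp: mult.commute sets.Int_space_eq2)
  let ?\<phi> = "\<lambda>x. \<phi> x * indicator A x"
  let ?D = "{z \<in> space \<mu> \<times> space \<mu>. fst z = snd z}"
  let ?N = "space \<mu> - C - A"
  have [measurable]: "?\<phi> \<in> borel_measurable \<mu>" by (rule \<phi>_meas)
  have inj: "inj_on \<phi> A" using bij by (simp add: bij_betw_def)
  have "?D = {z \<in> space (square \<mu>). ?\<phi> (fst z) = ?\<phi> (snd z) \<and> fst z \<in> A \<and> snd z \<in> A}
      \<union> (\<Union>x\<in>C. {x} \<times> {x}) \<union> (?D \<inter> ?N \<times> ?N)" (is "_ = ?A \<union> ?C \<union> _")
  proof (intro equalityI subsetI)
    fix z assume z: "z \<in> ?D"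
    then obtain x where x: "z = (x, x)" "x \<in> space \<mu>" by (auto simp: mem_Times_iff prod_eq_iff)
    then show "z \<in> ?A \<union> ?C \<union> (?D \<inter> ?N \<times> ?N)"
      by (cases "x \<in> A"; cases "x \<in> C") (simp_all add: space_pair_measure)
  next
    fix z assume "z \<in> ?A \<union> ?C \<union> (?D \<inter> ?N \<times> ?N)"
    then consider "z \<in> ?A" | "z \<in> ?C" | "z \<in> ?D" by blast
    then show "z \<in> ?D"
    proof cases
      case 1
      then have z: "fst z \<in> A" "snd z \<in> A" "?\<phi> (fst z) = ?\<phi> (snd z)" "z \<in> space (square \<mu>)"
        by blast+
      then have "\<phi> (fst z) = \<phi> (snd z)" "z \<in> space \<mu> \<times> space \<mu>"
        by (simp_all add: space_pair_measure)
      note this z(1,2)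
      then show ?thesis using inj_onD[OF inj] by blast
    next
      case 2
      then show ?thesis using C(1) by auto
    qed
  qed
  also have "\<dots> \<in> sets (square \<mu>)"
  proof (intro sets.Un)
    show "{z \<in> space (square \<mu>). ?\<phi> (fst z) = ?\<phi> (snd z) \<and> fst z \<in> A \<and> snd z \<in> A} \<in> sets (square \<mu>)"
      by measurable
    show "(\<Union>x\<in>C. {x} \<times> {x}) \<in> sets (square \<mu>)"
      using C by (intro sets.countable_UN'' sets_completionI_sets pair_measureI)
    show "?D \<inter> ?N \<times> ?N \<in> sets (square \<mu>)"
      \<comment> \<open>Nothing is known about the diagonal inside \<open>?N\<close>; this piece is
        measurable because the enclosing square is null and the measure is completed.\<close>
      by (rule sets_completionI_sub[of "?N \<times> ?N"])
        (use N0 in \<open>auto simp: null_sets_def emeasure_pair_measure_Times\<close>)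
  qed
  finally show ?thesis .
qed

section \<open>An upper bound for the m-norm\<close>

context complete_prob_space
begin

text \<open>
  Off the diagonal \<open>h x + h y + c\<close> satisfies the triangle inequality for every
  nonnegative \<open>h\<close>; setting it to zero on the diagonal yields a semimetric, which is where
  measurability of the diagonal is needed.
\<close>

lemma m_norm_le_sum:
  fixes h :: "'a \<Rightarrow> real"
  assumes diag: "{z \<in> space \<mu> \<times> space \<mu>. fst z = snd z} \<in> sets (square \<mu>)"
    and h [measurable]: "h \<in> borel_measurable \<mu>" and h_nonneg: "\<And>x. x \<in> space \<mu> \<Longrightarrow> 0 \<le> h x"
    and H: "(\<integral>\<^sup>+ x. ennreal (h x) \<partial>\<mu>) \<le> ennreal H" "0 \<le> H" and c: "0 \<le> c"
    and f: "\<And>x y. x \<in> space \<mu> \<Longrightarrow> y \<in> space \<mu> \<Longrightarrow> x \<noteq> y \<Longrightarrow> \<bar>f (x, y)\<bar> \<le> h x + h y + c"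
    and f_diag: "\<And>x. x \<in> space \<mu> \<Longrightarrow> f (x, x) = 0"
  shows "m_norm \<mu> f \<le> ennreal (2 * H + c)"
proof -
  define \<sigma> where "\<sigma> z = (if fst z = snd z then 0 else h (fst z) + h (snd z) + c)" for z
  have "{z \<in> space (square \<mu>). fst z = snd z} \<in> sets (square \<mu>)"
    using diag by (simp add: space_pair_measure mem_Times_iff)
  then have [measurable]: "Measurable.pred (square \<mu>) (\<lambda>z. fst z = snd z)"
    by (simp add: pred_def)
  have meas [measurable]: "\<sigma> \<in> borel_measurable (square \<mu>)"
    unfolding \<sigma>_def by measurable
  have nonneg: "0 \<le> \<sigma> z" if "z \<in> space (square \<mu>)" for z
    using that h_nonneg c by (auto simp: \<sigma>_def space_pair_measure)
  have "(\<integral>\<^sup>+ z. ennreal \<bar>\<sigma> z\<bar> \<partial>square \<mu>)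
      \<le> (\<integral>\<^sup>+ z. ennreal (h (fst z)) + ennreal (h (snd z)) + ennreal c \<partial>square \<mu>)"
    using h_nonneg c
    by (intro nn_integral_mono)
      (auto simp: \<sigma>_def space_pair_measure simp flip: ennreal_plus intro!: ennreal_leI)
  also have "\<dots> = (\<integral>\<^sup>+ x. ennreal (h x) \<partial>\<mu>) + (\<integral>\<^sup>+ x. ennreal (h x) \<partial>\<mu>) + ennreal c"
    using emeasure_square_space
    by (simp add: nn_integral_add nn_integral_square_fst[of "\<lambda>x. ennreal (h x)"]
        nn_integral_square_snd[of "\<lambda>x. ennreal (h x)"] del: emeasure_completion)
  also have "\<dots> \<le> ennreal H + ennreal H + ennreal c"
    using H by (intro add_mono) auto
  also have "\<dots> = ennreal (2 * H + c)"
    using H c by (simp flip: ennreal_plus)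
  finally have int: "(\<integral>\<^sup>+ z. ennreal \<bar>\<sigma> z\<bar> \<partial>square \<mu>) \<le> ennreal (2 * H + c)" .
  have "semimetric_on (space \<mu>) \<sigma>"
    unfolding semimetric_on_def \<sigma>_def using h_nonneg c
    by (auto simp: add_nonneg_nonneg)
  moreover have "integrable (square \<mu>) \<sigma>"
    using int by (auto simp: integrable_iff_bounded intro: order.strict_trans1)
  moreover have "AE z in square \<mu>. \<bar>f z\<bar> \<le> \<sigma> z"
    by (rule AE_I2) (use f f_diag in \<open>auto simp: \<sigma>_def space_pair_measure\<close>)
  ultimately have "m_norm \<mu> f \<le> (\<integral>\<^sup>+ z. ennreal \<bar>\<sigma> z\<bar> \<partial>square \<mu>)"
    unfolding m_norm_def by (intro INF_lower) (auto simp: summable_semimetric_def)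
  then show ?thesis using int by (rule order.trans)
qed

end

section \<open>Series of semimetrics, completeness of the m-norm and the net criterion\<close>

lemma semimetric_onD:
  assumes "semimetric_on X \<rho>"
  shows "x \<in> X \<Longrightarrow> y \<in> X \<Longrightarrow> 0 \<le> \<rho> (x, y)" "x \<in> X \<Longrightarrow> \<rho> (x, x) = 0"
    "x \<in> X \<Longrightarrow> y \<in> X \<Longrightarrow> \<rho> (x, y) = \<rho> (y, x)"
    "x \<in> X \<Longrightarrow> y \<in> X \<Longrightarrow> z \<in> X \<Longrightarrow> \<rho> (x, z) \<le> \<rho> (x, y) + \<rho> (y, z)"
  using assms unfolding semimetric_on_def by blast+

context complete_prob_space
begin

lemma summable_semimetricD:
  assumes "summable_semimetric \<mu> \<rho>"
  shows "semimetric_on (space \<mu>) \<rho>" "integrable (square \<mu>) \<rho>" "\<rho> \<in> borel_measurable (square \<mu>)"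
  using assms by (auto simp: summable_semimetric_def)

text \<open>
  The sum may be infinite on a null set; collapsing the exceptional points to a single good point
  turns it into a semimetric that is finite everywhere.
\<close>

lemma ex_semimetric_suminf:
  assumes \<sigma>: "\<And>n. summable_semimetric \<mu> (\<sigma> n)"
    and fin: "(\<Sum>n. \<integral>\<^sup>+ z. ennreal \<bar>\<sigma> n z\<bar> \<partial>square \<mu>) < \<infinity>"
  shows "\<exists>\<tau>. summable_semimetric \<mu> \<tau> \<and> (AE z in square \<mu>. (\<lambda>n. \<sigma> n z) sums \<tau> z) \<and>
           (\<integral>\<^sup>+ z. ennreal \<bar>\<tau> z\<bar> \<partial>square \<mu>) = (\<Sum>n. \<integral>\<^sup>+ z. ennreal \<bar>\<sigma> n z\<bar> \<partial>square \<mu>)"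
proof -
  note [measurable] = summable_semimetricD(3)[OF \<sigma>]
  note semi = semimetric_onD[OF summable_semimetricD(1)[OF \<sigma>]]
  define T where "T z = (\<Sum>n. ennreal \<bar>\<sigma> n z\<bar>)" for z
  have [measurable]: "T \<in> borel_measurable (square \<mu>)" unfolding T_def by measurable
  have int_T: "(\<integral>\<^sup>+ z. T z \<partial>square \<mu>) = (\<Sum>n. \<integral>\<^sup>+ z. ennreal \<bar>\<sigma> n z\<bar> \<partial>square \<mu>)"
    unfolding T_def by (rule nn_integral_suminf) measurable
  have "AE z in square \<mu>. T z \<noteq> \<infinity>"
    by (rule nn_integral_PInf_AE) (use int_T fin in auto)
  then have "AE x in \<mu>. AE y in \<mu>. T (x, y) \<noteq> \<infinity>" by (rule AE_square_D)
  \<comment> \<open>The constant integrand 0 with bound 1 reduces the averaging lemma to the bare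
    existence of a generic point.\<close>
  then obtain p where p: "p \<in> space \<mu>" and p_AE: "AE y in \<mu>. T (p, y) \<noteq> \<infinity>"
    using ex_AE_less[of _ "\<lambda>_. 0" 1] by auto
  \<comment> \<open>Finiteness of the sum from \<open>p\<close> to each of two points implies, by
    the triangle inequality through \<open>p\<close>, convergence between those points. Hence the
    series converges everywhere on \<open>Z \<times> Z\<close>.\<close>
  define Z where "Z = {y \<in> space \<mu>. T (p, y) \<noteq> \<infinity>}"
  have AE_Z: "AE y in \<mu>. y \<in> Z" using p_AE AE_space by eventually_elim (simp add: Z_def)
  have pZ: "p \<in> Z" using p semi(2) by (simp add: Z_def T_def)
  define r where "r y = (if y \<in> Z then y else p)" for y
  have rZ: "r y \<in> Z" for y using pZ by (simp add: r_def)
  have Z_space: "y \<in> Z \<Longrightarrow> y \<in> space \<mu>" for y by (simp add: Z_def)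
  note rX = Z_space[OF rZ]
  have summ: "summable (\<lambda>n. \<sigma> n (x, y))" if "x \<in> Z" "y \<in> Z" for x y
  proof -
    have "summable (\<lambda>n. \<bar>\<sigma> n (p, u)\<bar>)" if "u \<in> Z" for u
      using that by (intro summable_suminf_not_top) (auto simp: Z_def T_def)
    then have "summable (\<lambda>n. \<bar>\<sigma> n (p, x)\<bar> + \<bar>\<sigma> n (p, y)\<bar>)" using that by (intro summable_add) auto
    then show ?thesis
    proof (rule summable_comparison_test')
      fix n
      have "\<sigma> n (x, y) \<le> \<sigma> n (x, p) + \<sigma> n (p, y)" "\<sigma> n (x, p) = \<sigma> n (p, x)" "0 \<le> \<sigma> n (x, y)"
        using that Z_space p semi by metis+
      then show "norm (\<sigma> n (x, y)) \<le> \<bar>\<sigma> n (p, x)\<bar> + \<bar>\<sigma> n (p, y)\<bar>" by simp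
    qed
  qed
  define \<tau> where "\<tau> z = (\<Sum>n. \<sigma> n (r (fst z), r (snd z)))" for z
  have \<tau>_eq: "\<tau> z = (\<Sum>n. \<sigma> n z)" "(\<lambda>n. \<sigma> n z) sums \<tau> z" "ennreal \<bar>\<tau> z\<bar> = T z"
    if "fst z \<in> Z" "snd z \<in> Z" for z
  proof -
    have s: "summable (\<lambda>n. \<sigma> n z)" using summ[OF that] by simp
    have nn: "0 \<le> \<sigma> n z" for n using semi(1)[of "fst z" "snd z" n] that Z_space by simp
    show eq: "\<tau> z = (\<Sum>n. \<sigma> n z)" using that by (simp add: \<tau>_def r_def)
    show "(\<lambda>n. \<sigma> n z) sums \<tau> z" unfolding eq using s by (rule summable_sums)
    show "ennreal \<bar>\<tau> z\<bar> = T z"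
      using nn s by (simp add: eq T_def suminf_nonneg suminf_ennreal2)
  qed
  have AE_ZZ: "AE z in square \<mu>. fst z \<in> Z \<and> snd z \<in> Z"
    using AE_square_fst[OF AE_Z] AE_square_snd[OF AE_Z] by eventually_elim simp
  have "AE z in square \<mu>. (\<Sum>n. \<sigma> n z) = \<tau> z"
    using AE_ZZ by eventually_elim (simp add: \<tau>_eq)
  then have [measurable]: "\<tau> \<in> borel_measurable (square \<mu>)"
    by (rule completion.borel_measurable_AE_eq[rotated]) measurable
  have int_\<tau>: "(\<integral>\<^sup>+ z. ennreal \<bar>\<tau> z\<bar> \<partial>square \<mu>) = (\<Sum>n. \<integral>\<^sup>+ z. ennreal \<bar>\<sigma> n z\<bar> \<partial>square \<mu>)"
    unfolding int_T[symmetric]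
    by (rule nn_integral_cong_AE) (use AE_ZZ in eventually_elim, simp add: \<tau>_eq(3))
  have "semimetric_on (space \<mu>) \<tau>"
    unfolding semimetric_on_def
  proof (intro conjI ballI)
    fix x y z
    show "0 \<le> \<tau> (x, y)"
      unfolding \<tau>_def using summ[OF rZ rZ] semi(1)[OF rX rX] by (intro suminf_nonneg) auto
    show "\<tau> (x, x) = 0"
      using semi(2)[OF rX] by (simp add: \<tau>_def)
    show "\<tau> (x, y) = \<tau> (y, x)"
      unfolding \<tau>_def by (intro suminf_cong) (simp add: semi(3)[OF rX rX])
    have "\<tau> (x, z) \<le> (\<Sum>n. \<sigma> n (r x, r y) + \<sigma> n (r y, r z))"
      unfolding \<tau>_def using summ[OF rZ rZ] semi(4)[OF rX rX rX]
      by (intro suminf_le) (auto intro: summable_add)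
    also have "\<dots> = \<tau> (x, y) + \<tau> (y, z)"
      unfolding \<tau>_def using summ[OF rZ rZ] by (simp add: suminf_add)
    finally show "\<tau> (x, z) \<le> \<tau> (x, y) + \<tau> (y, z)" .
  qed
  moreover have "integrable (square \<mu>) \<tau>"
    using fin int_\<tau> by (simp add: integrable_iff_bounded)
  moreover have "AE z in square \<mu>. (\<lambda>n. \<sigma> n z) sums \<tau> z"
    using AE_ZZ by eventually_elim (simp add: \<tau>_eq(2))
  ultimately show ?thesis
    using int_\<tau> by (auto simp: summable_semimetric_def)
qed

lemma m_norm_lessE:
  assumes "m_norm \<mu> f < c"
  obtains \<sigma> where "summable_semimetric \<mu> \<sigma>" "AE z in square \<mu>. \<bar>f z\<bar> \<le> \<sigma> z"
    "(\<integral>\<^sup>+ z. ennreal \<bar>\<sigma> z\<bar> \<partial>square \<mu>) < c"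
  using assms unfolding m_norm_def INF_less_iff by blast

lemma m_norm_le:
  assumes "summable_semimetric \<mu> \<sigma>" "AE z in square \<mu>. \<bar>f z\<bar> \<le> \<sigma> z"
  shows "m_norm \<mu> f \<le> (\<integral>\<^sup>+ z. ennreal \<bar>\<sigma> z\<bar> \<partial>square \<mu>)"
  unfolding m_norm_def using assms by (intro INF_lower) auto

text \<open>Consecutive differences are dominated by semimetrics with geometrically decreasing
  integrals. The tail sums of these semimetrics are again summable semimetrics; they dominate the
  distance to the pointwise limit, and summing the geometric tail gives the factor 2.\<close>

lemma ex_m_limit:
  assumes f: "\<And>n. integrable (square \<mu>) (f n)"
    and close: "\<And>n. m_norm \<mu> (\<lambda>z. f n z - f (Suc n) z) < ennreal ((1/2) ^ n)"
  shows "\<exists>g. integrable (square \<mu>) g \<and>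
    (\<forall>n. m_norm \<mu> (\<lambda>z. f n z - g z) \<le> ennreal (2 * (1/2) ^ n))"
proof -
  have "\<forall>n. \<exists>\<sigma>. summable_semimetric \<mu> \<sigma> \<and> (AE z in square \<mu>. \<bar>f n z - f (Suc n) z\<bar> \<le> \<sigma> z) \<and>
    (\<integral>\<^sup>+ z. ennreal \<bar>\<sigma> z\<bar> \<partial>square \<mu>) < ennreal ((1/2) ^ n)"
  proof
    fix n
    from m_norm_lessE[OF close[of n]] obtain \<sigma> where "summable_semimetric \<mu> \<sigma>"
      "AE z in square \<mu>. \<bar>f n z - f (Suc n) z\<bar> \<le> \<sigma> z"
      "(\<integral>\<^sup>+ z. ennreal \<bar>\<sigma> z\<bar> \<partial>square \<mu>) < ennreal ((1/2) ^ n)" .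
    then show "\<exists>\<sigma>. summable_semimetric \<mu> \<sigma> \<and> (AE z in square \<mu>. \<bar>f n z - f (Suc n) z\<bar> \<le> \<sigma> z) \<and>
      (\<integral>\<^sup>+ z. ennreal \<bar>\<sigma> z\<bar> \<partial>square \<mu>) < ennreal ((1/2) ^ n)"
      by (intro exI conjI)
  qed
  from choice[OF this] obtain \<sigma> where \<sigma>: "\<And>n. summable_semimetric \<mu> (\<sigma> n)"
    and dom: "\<And>n. AE z in square \<mu>. \<bar>f n z - f (Suc n) z\<bar> \<le> \<sigma> n z"
    and small: "\<And>n. (\<integral>\<^sup>+ z. ennreal \<bar>\<sigma> n z\<bar> \<partial>square \<mu>) < ennreal ((1/2) ^ n)"
    unfolding all_conj_distrib by (elim exE conjE) (rule that; erule spec)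
  have geo: "(\<lambda>k. (1/2) ^ (k + n)) sums (2 * (1/2) ^ n :: real)" for n
    using sums_mult[OF geometric_sums[of "1/2 :: real"], of "(1/2) ^ n"]
    by (simp add: power_add mult.commute)
  have tail: "(\<Sum>k. \<integral>\<^sup>+ z. ennreal \<bar>\<sigma> (k + n) z\<bar> \<partial>square \<mu>) \<le> ennreal (2 * (1/2) ^ n)" for n
  proof -
    have "(\<Sum>k. \<integral>\<^sup>+ z. ennreal \<bar>\<sigma> (k + n) z\<bar> \<partial>square \<mu>) \<le> (\<Sum>k. ennreal ((1/2) ^ (k + n)))"
      using small by (intro suminf_le) (auto intro: less_imp_le)
    also have "\<dots> = ennreal (2 * (1/2) ^ n)"
      using geo[of n] by (subst suminf_ennreal2) (auto simp: sums_iff)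
    finally show ?thesis .
  qed
  have "\<forall>n. \<exists>\<tau>. summable_semimetric \<mu> \<tau> \<and> (AE z in square \<mu>. (\<lambda>k. \<sigma> (k + n) z) sums \<tau> z) \<and>
           (\<integral>\<^sup>+ z. ennreal \<bar>\<tau> z\<bar> \<partial>square \<mu>) = (\<Sum>k. \<integral>\<^sup>+ z. ennreal \<bar>\<sigma> (k + n) z\<bar> \<partial>square \<mu>)"
    by (intro allI ex_semimetric_suminf \<sigma> order.strict_trans1[OF tail]) simp
  from choice[OF this] obtain \<tau> where \<tau>: "\<And>n. summable_semimetric \<mu> (\<tau> n)"
    and \<tau>_sums: "\<And>n. AE z in square \<mu>. (\<lambda>k. \<sigma> (k + n) z) sums \<tau> n z"
    and "\<And>n. (\<integral>\<^sup>+ z. ennreal \<bar>\<tau> n z\<bar> \<partial>square \<mu>) = (\<Sum>k. \<integral>\<^sup>+ z. ennreal \<bar>\<sigma> (k + n) z\<bar> \<partial>square \<mu>)"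
    unfolding all_conj_distrib by (elim exE conjE) (rule that; erule spec)
  with tail have \<tau>_int: "(\<integral>\<^sup>+ z. ennreal \<bar>\<tau> n z\<bar> \<partial>square \<mu>) \<le> ennreal (2 * (1/2) ^ n)" for n
    by simp
  \<comment> \<open>The pointwise limit as a telescoping series. Where the series fails to converge
    the value is arbitrary, but this happens only on a null set.\<close>
  define g where "g z = f 0 z + (\<Sum>n. f (Suc n) z - f n z)" for z
  have f_meas [measurable]: "f n \<in> borel_measurable (square \<mu>)" for n using f[of n] by auto
  have [measurable]: "g \<in> borel_measurable (square \<mu>)" unfolding g_def by measurable
  have dom_all: "AE z in square \<mu>. \<forall>n. \<bar>f n z - f (Suc n) z\<bar> \<le> \<sigma> n z"
    using dom by (simp add: AE_all_countable)
  have bound: "AE z in square \<mu>. \<bar>f n z - g z\<bar> \<le> \<tau> n z" for n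
    \<comment> \<open>Index 0 gives convergence of the full dominating series, index
      \<open>n\<close> the value of its tail.\<close>
    using dom_all \<tau>_sums[of 0] \<tau>_sums[of n]
  proof eventually_elim
    case (elim z)
    define d where "d k = f (Suc k) z - f k z" for k
    have d_le: "\<bar>d k\<bar> \<le> \<sigma> k z" for k using elim(1) by (simp add: d_def abs_minus_commute)
    have "summable (\<lambda>k. \<sigma> k z)" using elim(2) by (simp add: sums_iff)
    then have abs: "summable (\<lambda>k. \<bar>d k\<bar>)"
      by (rule summable_comparison_test') (use d_le in simp)
    then have abs': "summable (\<lambda>k. \<bar>d (k + n)\<bar>)" by (rule summable_ignore_initial_segment)
    from abs have "summable d" by (rule summable_rabs_cancel)
    have "(\<Sum>k<n. d k) = f n z - f 0 z" by (induction n) (simp_all add: d_def)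
    with suminf_split_initial_segment[OF \<open>summable d\<close>, of n]
    have "suminf d = (\<Sum>k. d (k + n)) + (f n z - f 0 z)"
      by simp
    moreover have "g z = f 0 z + suminf d" by (simp add: g_def d_def[abs_def])
    ultimately have "f n z - g z = - (\<Sum>k. d (k + n))" by simp
    then have "\<bar>f n z - g z\<bar> = \<bar>\<Sum>k. d (k + n)\<bar>" by simp
    also have "\<dots> \<le> (\<Sum>k. \<bar>d (k + n)\<bar>)"
      using abs' by (rule summable_rabs)
    also have "\<dots> \<le> (\<Sum>k. \<sigma> (k + n) z)"
      using d_le abs' sums_summable[OF elim(3)] by (intro suminf_le)
    also have "\<dots> = \<tau> n z" using elim(3) by (simp add: sums_iff)
    finally show ?case .
  qed
  have "integrable (square \<mu>) (\<lambda>z. f 0 z - g z)"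
    by (rule Bochner_Integration.integrable_bound[OF summable_semimetricD(2)[OF \<tau>[of 0]]])
      (measurable, use bound[of 0] in eventually_elim, auto)
  from Bochner_Integration.integrable_diff[OF f[of 0] this] have "integrable (square \<mu>) g" by simp
  moreover have "m_norm \<mu> (\<lambda>z. f n z - g z) \<le> ennreal (2 * (1/2) ^ n)" for n
    using m_norm_le[OF \<tau> bound] \<tau>_int by (rule order.trans)
  ultimately show ?thesis by blast
qed

text \<open>A Cauchy sequence converges as soon as a subsequence does, and a subsequence whose
  consecutive distances decrease geometrically has a limit by \<open>ex_m_limit\<close>.\<close>

lemma mcomplete_m_space: "Metric_space.mcomplete (m_space \<mu>) (m_dist \<mu>)"
proof -
  interpret m: Metric_space "m_space \<mu>" "m_dist \<mu>" by (rule Metric_space_m_space)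
  show ?thesis
    unfolding m.mcomplete_def
  proof (intro allI impI)
    fix s assume cauchy: "m.MCauchy s"
    then have s: "s n \<in> m_space \<mu>" for n by (auto simp: m.MCauchy_def)
    have "\<exists>N. \<forall>k l. N \<le> k \<longrightarrow> N \<le> l \<longrightarrow> m_dist \<mu> (s k) (s l) < (1/2) ^ n" for n
      using cauchy by (auto simp: m.MCauchy_def)
    then obtain N where N: "\<And>n k l. N n \<le> k \<Longrightarrow> N n \<le> l \<Longrightarrow> m_dist \<mu> (s k) (s l) < (1/2) ^ n"
      by metis
    \<comment> \<open>These partial sums increase strictly, and both \<open>r n\<close> and
      \<open>r (Suc n)\<close> are at least \<open>N n\<close>, which is all that the choice of
      subsequence requires.\<close>
    define r where "r n = (\<Sum>i\<le>n. Suc (N i))" for n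
    have mono: "strict_mono r" by (rule strict_monoI_Suc) (simp add: r_def)
    have "N n \<le> r n" "N n \<le> r (Suc n)" for n by (cases n; simp add: r_def)+
    then have r: "m_dist \<mu> (s (r n)) (s (r (Suc n))) < (1/2) ^ n" for n
      by (intro N)
    have "\<exists>f. integrable (square \<mu>) f \<and> m_norm \<mu> f < \<infinity> \<and> s (r n) = L1_class (square \<mu>) f" for n
      using s[of "r n"] by (auto simp: m_space_def)
    then obtain f where f: "\<And>n. integrable (square \<mu>) (f n)" "\<And>n. m_norm \<mu> (f n) < \<infinity>"
      "\<And>n. s (r n) = L1_class (square \<mu>) (f n)" by metis
    have "m_norm \<mu> (\<lambda>z. f n z - f (Suc n) z) < ennreal ((1/2) ^ n)" for n
      using r[of n] m_norm_diff_finite[OF f(2)[of n] f(2)[of "Suc n"]] f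
      by (simp add: m_dist_L1_class enn2real_less_iff)
    from ex_m_limit[OF f(1) this] obtain g where g: "integrable (square \<mu>) g"
      and lim: "\<And>n. m_norm \<mu> (\<lambda>z. f n z - g z) \<le> ennreal (2 * (1/2) ^ n)" by blast
    have "m_norm \<mu> (\<lambda>z. f 0 z - g z) < \<infinity>"
      using lim[of 0] by (auto intro: order.strict_trans1)
    from m_norm_diff_finite[OF f(2)[of 0] this] have "m_norm \<mu> g < \<infinity>" by simp
    then have g_in: "L1_class (square \<mu>) g \<in> m_space \<mu>" using g by (auto simp: m_space_def)
    have dist_g: "m_dist \<mu> (s (r n)) (L1_class (square \<mu>) g) \<le> 2 * (1/2) ^ n" for n
      using lim[of n] f g by (auto simp: m_dist_L1_class intro: enn2real_leI)
    have "(\<lambda>n. 2 * (1/2) ^ n :: real) \<longlonglongrightarrow> 0"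
      by real_asymp
    then have ev0: "\<forall>\<^sub>F n in sequentially. 2 * (1/2) ^ n < e" if "0 < e" for e :: real
      using that by (rule order_tendstoD)
    have ev: "\<forall>\<^sub>F n in sequentially. m_dist \<mu> (s (r n)) (L1_class (square \<mu>) g) < e" if "0 < e" for e
      using ev0[OF that] by (rule eventually_mono) (rule order.strict_trans1[OF dist_g])
    have "limitin m.mtopology (s \<circ> r) (L1_class (square \<mu>) g) sequentially"
      unfolding m.limitin_metric using s g_in ev by simp
    from m.MCauchy_convergent_subsequence[OF cauchy mono this]
    show "\<exists>x. limitin m.mtopology s x sequentially" by blast
  qed
qed

text \<open>By completeness, compactness of the closure amounts to total boundedness, with nets
  centred in the set itself. A finite net of classes lifts to finitely many representatives in
  \<open>K\<close>, and since differences have finite m-norm, \<open>m_dist\<close> can be replaced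
  by \<open>m_norm\<close>.\<close>

lemma m_precompact_iff:
  assumes "\<And>\<rho>. \<rho> \<in> K \<Longrightarrow> summable_semimetric \<mu> \<rho>"
  shows "m_precompact \<mu> K \<longleftrightarrow>
    (\<forall>e>0. \<exists>F\<subseteq>K. finite F \<and> (\<forall>\<rho>\<in>K. \<exists>\<sigma>\<in>F. m_norm \<mu> (\<lambda>z. \<sigma> z - \<rho> z) < ennreal e))"
proof -
  interpret m: Metric_space "m_space \<mu>" "m_dist \<mu>" by (rule Metric_space_m_space)
  let ?c = "L1_class (square \<mu>)"
  have sub: "?c ` K \<subseteq> m_space \<mu>" using L1_class_in_m_space assms by blast
  have dist: "?c \<rho> \<in> m.mball (?c \<sigma>) e \<longleftrightarrow> m_norm \<mu> (\<lambda>z. \<sigma> z - \<rho> z) < ennreal e"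
    if "\<rho> \<in> K" "\<sigma> \<in> K" "0 < e" for \<rho> \<sigma> e
  proof -
    have fin: "m_norm \<mu> \<rho> < \<infinity>" if "\<rho> \<in> K" for \<rho>
      using m_norm_summable_semimetric[OF assms[OF that]] summable_semimetricD(2)[OF assms[OF that]]
      by (simp add: integrable_iff_bounded)
    have "?c \<rho> \<in> m_space \<mu>" "?c \<sigma> \<in> m_space \<mu>" using sub that by auto
    then show ?thesis
      using that m_norm_diff_finite[OF fin fin, of \<sigma> \<rho>] summable_semimetricD(2)[OF assms]
      by (simp add: m_dist_L1_class enn2real_less_iff)
  qed
  have "m_precompact \<mu> K \<longleftrightarrow> m.mtotally_bounded (?c ` K)"
    unfolding m_precompact_def using m.mtotally_bounded_eq_compact_closure_of[OF mcomplete_m_space] sub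
    by blast
  also have "\<dots> \<longleftrightarrow> (\<forall>e>0. \<exists>F\<subseteq>K. finite F \<and> ?c ` K \<subseteq> (\<Union>\<sigma>\<in>F. m.mball (?c \<sigma>) e))"
    unfolding m.mtotally_bounded_def
  proof (intro all_cong1 imp_cong refl iffI)
    fix e :: real
    assume "\<exists>G. finite G \<and> G \<subseteq> ?c ` K \<and> ?c ` K \<subseteq> (\<Union>x\<in>G. m.mball x e)"
    then obtain G where G: "finite G" "G \<subseteq> ?c ` K" "?c ` K \<subseteq> (\<Union>x\<in>G. m.mball x e)" by (elim exE conjE)
    obtain F where "F \<subseteq> K" "finite F" "G = ?c ` F"
      using finite_subset_image[OF G(1,2)] by (elim exE conjE)
    with G(3) show "\<exists>F\<subseteq>K. finite F \<and> ?c ` K \<subseteq> (\<Union>\<sigma>\<in>F. m.mball (?c \<sigma>) e)"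
      by (intro exI[of _ F]) (simp only: image_image UN_simps SUP_image simp_thms)
  next
    fix e :: real
    assume "\<exists>F\<subseteq>K. finite F \<and> ?c ` K \<subseteq> (\<Union>\<sigma>\<in>F. m.mball (?c \<sigma>) e)"
    then obtain F where "F \<subseteq> K" "finite F" "?c ` K \<subseteq> (\<Union>\<sigma>\<in>F. m.mball (?c \<sigma>) e)" by (elim exE conjE)
    then show "\<exists>G. finite G \<and> G \<subseteq> ?c ` K \<and> ?c ` K \<subseteq> (\<Union>x\<in>G. m.mball x e)"
      by (intro exI[of _ "?c ` F"] conjI finite_imageI image_mono) (simp_all only: UN_simps)
  qed
  also have "\<dots> \<longleftrightarrow> (\<forall>e>0. \<exists>F\<subseteq>K. finite F \<and> (\<forall>\<rho>\<in>K. \<exists>\<sigma>\<in>F. m_norm \<mu> (\<lambda>z. \<sigma> z - \<rho> z) < ennreal e))"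
  proof (intro all_cong1 imp_cong ex_cong1 conj_cong refl)
    fix e :: real and F assume "0 < e" "F \<subseteq> K"
    have "?c ` K \<subseteq> (\<Union>\<sigma>\<in>F. m.mball (?c \<sigma>) e) \<longleftrightarrow> (\<forall>\<rho>\<in>K. \<exists>\<sigma>\<in>F. ?c \<rho> \<in> m.mball (?c \<sigma>) e)"
      by (simp only: image_subset_iff UN_iff)
    also have "\<dots> \<longleftrightarrow> (\<forall>\<rho>\<in>K. \<exists>\<sigma>\<in>F. m_norm \<mu> (\<lambda>z. \<sigma> z - \<rho> z) < ennreal e)"
      using \<open>F \<subseteq> K\<close> \<open>0 < e\<close> by (intro ball_cong bex_cong refl dist) auto
    finally show "?c ` K \<subseteq> (\<Union>\<sigma>\<in>F. m.mball (?c \<sigma>) e) \<longleftrightarrow>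
        (\<forall>\<rho>\<in>K. \<exists>\<sigma>\<in>F. m_norm \<mu> (\<lambda>z. \<sigma> z - \<rho> z) < ennreal e)" .
  qed
  finally show ?thesis .
qed

end

section \<open>Uniform integrability from finite nets\<close>

text \<open>The tail integral decreases in \<open>R\<close>, so smallness at a single threshold
  already gives the limit. The threshold can be taken nonnegative because smallness holds
  eventually.\<close>

lemma uniformly_integrable_iff:
  "uniformly_integrable N K \<longleftrightarrow> (\<forall>e>0. \<exists>R\<ge>0. \<forall>f\<in>K.
     (\<integral>\<^sup>+ z. ennreal \<bar>f z\<bar> * indicator {z. R < \<bar>f z\<bar>} z \<partial>N) \<le> ennreal e)"
  (is "_ \<longleftrightarrow> (\<forall>e>0. \<exists>R\<ge>0. \<forall>f\<in>K. ?I f R \<le> ennreal e)")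
proof
  assume *: "uniformly_integrable N K"
  show "\<forall>e>0. \<exists>R\<ge>0. \<forall>f\<in>K. ?I f R \<le> ennreal e"
  proof (intro allI impI)
    fix e :: real assume "0 < e"
    then have "\<forall>\<^sub>F R in at_top. (SUP f\<in>K. ?I f R) < ennreal e"
      using * unfolding uniformly_integrable_def by (intro order_tendstoD(2)) auto
    then have "\<forall>\<^sub>F R in at_top. 0 \<le> R \<and> (SUP f\<in>K. ?I f R) < ennreal e"
      using eventually_ge_at_top[of 0] by eventually_elim simp
    then obtain R where R: "0 \<le> R" "(SUP f\<in>K. ?I f R) < ennreal e"
      using eventually_happens'[OF trivial_limit_at_top_linorder] by blast
    have "?I f R \<le> ennreal e" if "f \<in> K" for f
      using SUP_upper[OF that, of "\<lambda>f. ?I f R"] R(2) by (auto intro: order.trans less_imp_le)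
    with R(1) show "\<exists>R\<ge>0. \<forall>f\<in>K. ?I f R \<le> ennreal e" by blast
  qed
next
  assume *: "\<forall>e>0. \<exists>R\<ge>0. \<forall>f\<in>K. ?I f R \<le> ennreal e"
  show "uniformly_integrable N K"
    unfolding uniformly_integrable_def
  proof (rule order_tendstoI)
    fix a :: ennreal assume "0 < a"
    then obtain b where b: "0 < b" "b < a" using dense by blast
    then obtain e where e: "b = ennreal e" "0 < e"
      by (cases b) (auto simp: ennreal_less_zero_iff)
    with * obtain R where R: "\<And>f. f \<in> K \<Longrightarrow> ?I f R \<le> ennreal e" by blast
    have "(SUP f\<in>K. ?I f R') < a" if "R \<le> R'" for R'
    proof -
      have "?I f R' \<le> ?I f R" for f
        using that by (intro nn_integral_mono) (auto simp: indicator_def)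
      then have "(SUP f\<in>K. ?I f R') \<le> ennreal e"
        using R by (intro SUP_least) (auto intro: order.trans)
      with b e show ?thesis by simp
    qed
    then show "\<forall>\<^sub>F R in at_top. (SUP f\<in>K. ?I f R) < a"
      unfolding eventually_at_top_linorder by blast
  qed simp
qed

text \<open>Dominated convergence: at each point the truncated integrand vanishes once the threshold
  exceeds the finite value of the function.\<close>

lemma integrable_tail:
  assumes f: "integrable N f" and e: "0 < e"
  shows "\<exists>R\<ge>0. (\<integral>\<^sup>+ z. ennreal \<bar>f z\<bar> * indicator {z. R < \<bar>f z\<bar>} z \<partial>N) \<le> ennreal e"
proof -
  have [measurable]: "f \<in> borel_measurable N" using f by auto
  have "(\<lambda>n. \<integral>\<^sup>+ z. (if real n < \<bar>f z\<bar> then ennreal \<bar>f z\<bar> else 0) \<partial>N) \<longlonglongrightarrow> (\<integral>\<^sup>+ z. 0 \<partial>N)"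
  proof (rule nn_integral_dominated_convergence[where w = "\<lambda>z. ennreal \<bar>f z\<bar>"])
    show "(\<integral>\<^sup>+ z. ennreal \<bar>f z\<bar> \<partial>N) < \<infinity>" using f by (simp add: integrable_iff_bounded)
    show "AE z in N. (\<lambda>n. if real n < \<bar>f z\<bar> then ennreal \<bar>f z\<bar> else 0) \<longlonglongrightarrow> 0"
    proof (rule AE_I2)
      fix z
      obtain m where "\<bar>f z\<bar> \<le> real m" using real_arch_simple by blast
      then have "\<forall>\<^sub>F n in sequentially. (if real n < \<bar>f z\<bar> then ennreal \<bar>f z\<bar> else 0) = 0"
        by (intro eventually_sequentiallyI[of m]) auto
      then show "(\<lambda>n. if real n < \<bar>f z\<bar> then ennreal \<bar>f z\<bar> else 0) \<longlonglongrightarrow> 0"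
        by (rule tendsto_eventually)
    qed
  qed auto
  then have "\<forall>\<^sub>F n in sequentially. (\<integral>\<^sup>+ z. (if real n < \<bar>f z\<bar> then ennreal \<bar>f z\<bar> else 0) \<partial>N) < ennreal e"
    using e by (intro order_tendstoD(2)) auto
  then obtain n where n: "(\<integral>\<^sup>+ z. (if real n < \<bar>f z\<bar> then ennreal \<bar>f z\<bar> else 0) \<partial>N) < ennreal e"
    using eventually_happens'[OF sequentially_bot] by blast
  have "(\<integral>\<^sup>+ z. ennreal \<bar>f z\<bar> * indicator {z. real n < \<bar>f z\<bar>} z \<partial>N)
      = (\<integral>\<^sup>+ z. (if real n < \<bar>f z\<bar> then ennreal \<bar>f z\<bar> else 0) \<partial>N)"
    by (intro nn_integral_cong) (auto simp: indicator_def)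
  with n show ?thesis by (intro exI[of _ "real n"]) auto
qed

context complete_prob_space
begin

text \<open>Where \<rho> is large, either the nearby net element \<sigma> exceeds its own threshold
  or the difference carries at least half of \<rho>. So the tail of \<rho> is at most the tail of
  \<sigma> plus twice the L1-distance, which the m-norm controls; the budget is \<open>e/2\<close>
  plus twice \<open>e/4\<close>.\<close>

lemma uniformly_integrable_if_m_nets:
  assumes K: "\<And>\<rho>. \<rho> \<in> K \<Longrightarrow> integrable (square \<mu>) \<rho>"
    and nets: "\<And>e::real. 0 < e \<Longrightarrow>
      \<exists>F\<subseteq>K. finite F \<and> (\<forall>\<rho>\<in>K. \<exists>\<sigma>\<in>F. m_norm \<mu> (\<lambda>z. \<sigma> z - \<rho> z) < ennreal e)"
  shows "uniformly_integrable (square \<mu>) K"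
  unfolding uniformly_integrable_iff
proof (intro allI impI)
  fix e :: real assume e: "0 < e"
  then obtain F where F: "F \<subseteq> K" "finite F"
    and net: "\<And>\<rho>. \<rho> \<in> K \<Longrightarrow> \<exists>\<sigma>\<in>F. m_norm \<mu> (\<lambda>z. \<sigma> z - \<rho> z) < ennreal (e/4)"
    using nets[of "e/4"] by auto
  have "\<forall>\<sigma>\<in>F. \<exists>R\<ge>0. (\<integral>\<^sup>+ z. ennreal \<bar>\<sigma> z\<bar> * indicator {z. R < \<bar>\<sigma> z\<bar>} z \<partial>square \<mu>) \<le> ennreal (e/2)"
    using F(1) K e by (intro ballI integrable_tail) auto
  from bchoice[OF this] obtain r where r: "\<And>\<sigma>. \<sigma> \<in> F \<Longrightarrow> 0 \<le> r \<sigma>"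
    "\<And>\<sigma>. \<sigma> \<in> F \<Longrightarrow>
      (\<integral>\<^sup>+ z. ennreal \<bar>\<sigma> z\<bar> * indicator {z. r \<sigma> < \<bar>\<sigma> z\<bar>} z \<partial>square \<mu>) \<le> ennreal (e/2)"
    by (elim exE) blast
  \<comment> \<open>The sum of the finitely many nonnegative thresholds serves as a common upper
    bound.\<close>
  define R where "R = (\<Sum>\<sigma>\<in>F. r \<sigma>)"
  have rR: "r \<sigma> \<le> R" if "\<sigma> \<in> F" for \<sigma>
    unfolding R_def using that r(1) F(2) by (intro member_le_sum) auto
  have "(\<integral>\<^sup>+ z. ennreal \<bar>\<rho> z\<bar> * indicator {z. 2 * R < \<bar>\<rho> z\<bar>} z \<partial>square \<mu>) \<le> ennreal e"
    if \<rho>: "\<rho> \<in> K" for \<rho>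
  proof -
    obtain \<sigma> where \<sigma>: "\<sigma> \<in> F" "m_norm \<mu> (\<lambda>z. \<sigma> z - \<rho> z) < ennreal (e/4)" using net[OF \<rho>] by blast
    then have [measurable]: "\<sigma> \<in> borel_measurable (square \<mu>)" "\<rho> \<in> borel_measurable (square \<mu>)"
      using K[of \<sigma>] K[OF \<rho>] F(1) by auto
    have "(\<integral>\<^sup>+ z. ennreal \<bar>\<rho> z\<bar> * indicator {z. 2 * R < \<bar>\<rho> z\<bar>} z \<partial>square \<mu>)
      \<le> (\<integral>\<^sup>+ z. ennreal \<bar>\<sigma> z\<bar> * indicator {z. r \<sigma> < \<bar>\<sigma> z\<bar>} z + 2 * ennreal \<bar>\<sigma> z - \<rho> z\<bar> \<partial>square \<mu>)"
    proof (rule nn_integral_mono)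
      fix z
      show "ennreal \<bar>\<rho> z\<bar> * indicator {z. 2 * R < \<bar>\<rho> z\<bar>} z
        \<le> ennreal \<bar>\<sigma> z\<bar> * indicator {z. r \<sigma> < \<bar>\<sigma> z\<bar>} z + 2 * ennreal \<bar>\<sigma> z - \<rho> z\<bar>"
      proof (cases "2 * R < \<bar>\<rho> z\<bar>")
        case big: True
        have two: "2 * ennreal \<bar>\<sigma> z - \<rho> z\<bar> = ennreal (2 * \<bar>\<sigma> z - \<rho> z\<bar>)"
          by (simp add: ennreal_mult)
        show ?thesis
        proof (cases "r \<sigma> < \<bar>\<sigma> z\<bar>")
          case True
          moreover have "\<bar>\<rho> z\<bar> \<le> \<bar>\<sigma> z\<bar> + 2 * \<bar>\<sigma> z - \<rho> z\<bar>" by (smt (verit))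
          ultimately show ?thesis using big unfolding two
            by (auto simp flip: ennreal_plus intro!: ennreal_leI)
        next
          case False
          \<comment> \<open>Here \<open>\<sigma>\<close> is at most \<open>R\<close> in absolute
            value, hence less than half of \<open>\<rho>\<close>.\<close>
          then have "\<bar>\<rho> z\<bar> \<le> 2 * \<bar>\<sigma> z - \<rho> z\<bar>" using big rR[OF \<sigma>(1)] by (smt (verit))
          then show ?thesis using big False unfolding two by (auto intro!: ennreal_leI)
        qed
      qed simp
    qed
    also have "\<dots> = (\<integral>\<^sup>+ z. ennreal \<bar>\<sigma> z\<bar> * indicator {z. r \<sigma> < \<bar>\<sigma> z\<bar>} z \<partial>square \<mu>)
        + 2 * (\<integral>\<^sup>+ z. ennreal \<bar>\<sigma> z - \<rho> z\<bar> \<partial>square \<mu>)"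
      by (subst nn_integral_add) (auto simp: nn_integral_cmult)
    also have "\<dots> \<le> ennreal (e/2) + 2 * ennreal (e/4)"
      using r(2)[OF \<sigma>(1)] L1_norm_le_m_norm[of \<mu> "\<lambda>z. \<sigma> z - \<rho> z"] \<sigma>(2)
      by (intro add_mono mult_left_mono) auto
    also have "2 * ennreal (e/4) = ennreal (e/2)"
      using e ennreal_mult[of 2 "e/4"] by simp
    also have "ennreal (e/2) + ennreal (e/2) = ennreal e"
      using e by (simp flip: ennreal_plus)
    finally show ?thesis .
  qed
  moreover have "0 \<le> 2 * R" using r(1) by (simp add: R_def sum_nonneg)
  ultimately show "\<exists>R\<ge>0. \<forall>\<rho>\<in>K.
      (\<integral>\<^sup>+ z. ennreal \<bar>\<rho> z\<bar> * indicator {z. R < \<bar>\<rho> z\<bar>} z \<partial>square \<mu>) \<le> ennreal e"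
    by blast
qed

section \<open>Common partitions and uniform admissibility from finite nets\<close>

text \<open>By separability countably many balls of radius \<open>e/2\<close> cover almost all of
  the space, so finitely many of them miss a set of measure below \<open>d\<close>. The colour of a
  point is the index of the first ball containing it. Colours rather than cells are used because
  they combine easily for several semimetrics.\<close>

lemma admissible_colouring:
  assumes \<rho>: "admissible_semimetric \<mu> \<rho>" and e: "0 < e" and d: "0 < d"
  shows "\<exists>c :: 'a \<Rightarrow> nat. \<exists>n. \<exists>A\<in>sets \<mu>. c \<in> measurable \<mu> (count_space UNIV) \<and> (\<forall>x. c x \<le> n) \<and>
    measure \<mu> A < d \<and> (\<forall>x\<in>space \<mu> - A. \<forall>y\<in>space \<mu> - A. c x = c y \<longrightarrow> \<rho> (x, y) \<le> e)"
proof -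
  from \<rho> have summ: "summable_semimetric \<mu> \<rho>" by (simp add: admissible_semimetric_def)
  note semi = semimetric_onD[OF summable_semimetricD(1)[OF summ]]
  from \<rho> obtain X D where X: "X \<in> sets \<mu>" "emeasure \<mu> (space \<mu> - X) = 0"
    and D: "D \<subseteq> X" "countable D" "\<And>x e. x \<in> X \<Longrightarrow> 0 < e \<Longrightarrow> \<exists>d\<in>D. \<rho> (x, d) < e"
    unfolding admissible_semimetric_def semimetric_separable_def by blast
  have X_space: "x \<in> X \<Longrightarrow> x \<in> space \<mu>" for x using X(1) sets.sets_into_space by blast
  define Y where "Y = {x \<in> X. (\<lambda>y. \<rho> (x, y)) \<in> borel_measurable \<mu>}"
  have "AE x in \<mu>. x \<in> X"
    by (rule AE_I[of _ _ "space \<mu> - X"]) (use X in auto)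
  then have AE_Y: "AE x in \<mu>. x \<in> Y"
    using borel_measurable_section[OF summable_semimetricD(3)[OF summ]]
    by eventually_elim (simp add: Y_def)
  \<comment> \<open>A point of the dense set may have a nonmeasurable section. It is replaced by a
    point of \<open>Y\<close> within \<open>e/4\<close>, whenever there is one; two such distances
    add up to the radius \<open>e/2\<close>.\<close>
  define near where "near a x \<longleftrightarrow> x \<in> Y \<and> \<rho> (x, a) < e/4" for a x
  define E where "E = (\<lambda>a. SOME x. near a x) ` {a \<in> D. \<exists>x. near a x}"
  have "countable E" unfolding E_def using D(2) by (intro countable_image countable_subset[OF _ D(2)]) auto
  have E_Y: "E \<subseteq> Y"
  proof
    fix x assume "x \<in> E"
    then obtain a where "x = (SOME x. near a x)" "\<exists>x. near a x" by (auto simp: E_def)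
    then have "near a x" by (simp add: someI_ex)
    then show "x \<in> Y" by (simp add: near_def)
  qed
  have dense: "\<exists>p\<in>E. \<rho> (p, x) < e/2" if x: "x \<in> Y" for x
  proof -
    obtain a where a: "a \<in> D" "\<rho> (x, a) < e/4" using D(3)[of x "e/4"] x e by (auto simp: Y_def)
    let ?p = "SOME x. near a x"
    have near: "near a ?p" using a x by (intro someI[of "near a" x]) (simp add: near_def)
    then have "?p \<in> E" using a by (auto simp: E_def)
    have sp: "x \<in> space \<mu>" "?p \<in> space \<mu>" "a \<in> space \<mu>"
      using x near a(1) D(1) X_space by (auto simp: Y_def near_def)
    have "\<rho> (?p, x) \<le> \<rho> (?p, a) + \<rho> (a, x)" by (rule semi(4)) (use sp in auto)
    moreover have "\<rho> (a, x) = \<rho> (x, a)" by (rule semi(3)) (use sp in auto)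
    ultimately have "\<rho> (?p, x) < e/2" using near a(2) unfolding near_def by linarith
    with \<open>?p \<in> E\<close> show ?thesis by blast
  qed
  have "\<exists>x\<in>space \<mu>. x \<in> Y" using ex_AE_less[OF AE_Y, of "\<lambda>_. 0" 1] by auto
  then have "E \<noteq> {}" using dense by blast
  define p where "p = from_nat_into E"
  have p_E: "p i \<in> E" for i using \<open>E \<noteq> {}\<close> by (simp add: p_def from_nat_into)
  have p_range: "range p = E" using \<open>E \<noteq> {}\<close> \<open>countable E\<close> by (simp add: p_def range_from_nat_into)
  have p_space: "p i \<in> space \<mu>" for i using p_E[of i] E_Y X_space by (auto simp: Y_def)
  have [measurable]: "(\<lambda>y. \<rho> (p i, y)) \<in> borel_measurable \<mu>" for i
    using p_E[of i] E_Y by (auto simp: Y_def)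
  \<comment> \<open>The part missed by the first \<open>n\<close> balls. It decreases to a null set,
    because all balls together cover \<open>Y\<close>.\<close>
  define A where "A n = {x \<in> space \<mu>. \<forall>i<n. \<not> \<rho> (p i, x) < e/2}" for n :: nat
  have A_sets [measurable]: "A n \<in> sets \<mu>" for n unfolding A_def by measurable
  have "decseq A" by (auto simp: decseq_def A_def)
  then have "(\<lambda>n. measure \<mu> (A n)) \<longlonglongrightarrow> measure \<mu> (\<Inter>n. A n)"
    by (intro finite_Lim_measure_decseq) auto
  moreover have "measure \<mu> (\<Inter>n. A n) = 0"
  proof (subst prob_eq_0)
    show "AE x in \<mu>. x \<notin> (\<Inter>n. A n)"
      using AE_Y
    proof eventually_elim
      case (elim x)
      then obtain i where "\<rho> (p i, x) < e/2" using dense p_range by blast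
      then have "x \<notin> A (Suc i)" by (auto simp: A_def)
      then show ?case by blast
    qed
  qed auto
  ultimately have "\<forall>\<^sub>F n in sequentially. measure \<mu> (A n) < d"
    using d by (intro order_tendstoD(2)) auto
  then obtain n where n: "measure \<mu> (A n) < d"
    using eventually_happens'[OF sequentially_bot] by blast
  \<comment> \<open>The alternative \<open>i = n\<close> keeps the minimum well defined and bounded.
    Off \<open>A n\<close> a smaller index qualifies, so there the colour always names an actual
    ball.\<close>
  define c where "c x = (LEAST i. i = n \<or> \<rho> (p i, x) < e/2)" for x
  have "c \<in> measurable \<mu> (count_space UNIV)" unfolding c_def by measurable
  moreover have "c x \<le> n" for x unfolding c_def by (intro Least_le) simp
  moreover have "\<rho> (x, y) \<le> e" if "x \<in> space \<mu> - A n" "y \<in> space \<mu> - A n" "c x = c y" for x y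
  proof -
    have *: "\<rho> (p (c u), u) < e/2" if u: "u \<in> space \<mu> - A n" for u
    proof -
      obtain i where i: "i < n" "\<rho> (p i, u) < e/2" using u by (auto simp: A_def)
      then have "c u \<le> i" unfolding c_def by (intro Least_le) simp
      moreover have "c u = n \<or> \<rho> (p (c u), u) < e/2"
        unfolding c_def by (rule LeastI[of "\<lambda>i. i = n \<or> \<rho> (p i, u) < e/2" n]) simp
      ultimately show ?thesis using i(1) by linarith
    qed
    have "\<rho> (x, y) \<le> \<rho> (x, p (c x)) + \<rho> (p (c x), y)" by (rule semi(4)) (use that p_space in auto)
    moreover have "\<rho> (x, p (c x)) = \<rho> (p (c x), x)" by (rule semi(3)) (use that p_space in auto)
    ultimately show ?thesis using *[OF that(1)] *[OF that(2)] that(3) by simp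
  qed
  ultimately show ?thesis using n A_sets by blast
qed

text \<open>The cells are the classes of points with the same tuple of colours for all members of
  \<open>F\<close>; bounded colours leave finitely many tuples. The exceptional sets of the
  individual colourings are united.\<close>

lemma ex_common_partition:
  assumes F: "finite F" "\<And>\<rho>. \<rho> \<in> F \<Longrightarrow> admissible_semimetric \<mu> \<rho>" and e: "0 < e" and d: "0 < d"
  shows "\<exists>P A. finite P \<and> partition_on (space \<mu>) P \<and> P \<subseteq> sets \<mu> \<and> A \<in> sets \<mu> \<and> measure \<mu> A < d \<and>
    (\<forall>\<rho>\<in>F. \<forall>Y\<in>P. \<forall>x\<in>Y - A. \<forall>y\<in>Y - A. \<rho> (x, y) \<le> e)"
proof -
  \<comment> \<open>The added 1 covers empty \<open>F\<close> and makes the total of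
    \<open>card F\<close> exceptional measures strictly less than \<open>d\<close>.\<close>
  define d' where "d' = d / (card F + 1)"
  have d': "0 < d'" using d by (simp add: d'_def)
  define good :: "('a \<times> 'a \<Rightarrow> real) \<Rightarrow> ('a \<Rightarrow> nat) \<times> nat \<times> 'a set \<Rightarrow> bool" where
    "good \<rho> = (\<lambda>(c, n, A). A \<in> sets \<mu> \<and> c \<in> measurable \<mu> (count_space UNIV) \<and> (\<forall>x. c x \<le> n) \<and>
      measure \<mu> A < d' \<and> (\<forall>x\<in>space \<mu> - A. \<forall>y\<in>space \<mu> - A. c x = c y \<longrightarrow> \<rho> (x, y) \<le> e))" for \<rho>
  have "\<forall>\<rho>\<in>F. \<exists>q. good \<rho> q"
  proof
    fix \<rho> assume "\<rho> \<in> F"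
    from admissible_colouring[OF F(2)[OF this] e d'] obtain c n A where "good \<rho> (c, n, A)"
      unfolding good_def by blast
    then show "\<exists>q. good \<rho> q" ..
  qed
  from bchoice[OF this] obtain q where q: "\<forall>\<rho>\<in>F. good \<rho> (q \<rho>)" by (elim exE)
  define c :: "('a \<times> 'a \<Rightarrow> real) \<Rightarrow> 'a \<Rightarrow> nat" where "c \<rho> = fst (q \<rho>)" for \<rho>
  define n where "n \<rho> = fst (snd (q \<rho>))" for \<rho>
  define A where "A \<rho> = snd (snd (q \<rho>))" for \<rho>
  have A: "A \<rho> \<in> sets \<mu>" "measure \<mu> (A \<rho>) < d'" and c: "c \<rho> \<in> measurable \<mu> (count_space UNIV)"
    and n: "c \<rho> x \<le> n \<rho>"
    and close: "\<lbrakk>x \<in> space \<mu> - A \<rho>; y \<in> space \<mu> - A \<rho>; c \<rho> x = c \<rho> y\<rbrakk> \<Longrightarrow> \<rho> (x, y) \<le> e"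
    if "\<rho> \<in> F" for \<rho> x y
    using q that by (auto simp: good_def c_def n_def A_def split_beta)
  define cell where "cell x = {y \<in> space \<mu>. \<forall>\<rho>\<in>F. c \<rho> y = c \<rho> x}" for x
  have "finite (PiE F (\<lambda>\<rho>. {..n \<rho>}))" using F(1) by (intro finite_PiE) auto
  moreover have "(\<lambda>x. restrict (\<lambda>\<rho>. c \<rho> x) F) ` space \<mu> \<subseteq> PiE F (\<lambda>\<rho>. {..n \<rho>})"
    using n by auto
  ultimately have fin: "finite ((\<lambda>x. restrict (\<lambda>\<rho>. c \<rho> x) F) ` space \<mu>)"
    by (rule finite_subset[rotated])
  have "cell ` space \<mu> = (\<lambda>g. {y \<in> space \<mu>. \<forall>\<rho>\<in>F. c \<rho> y = g \<rho>}) `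
      ((\<lambda>x. restrict (\<lambda>\<rho>. c \<rho> x) F) ` space \<mu>)"
    unfolding image_image by (intro image_cong refl) (auto simp: cell_def)
  then have fin_cells: "finite (cell ` space \<mu>)" using fin by simp
  have cells_partition: "partition_on (space \<mu>) (cell ` space \<mu>)"
  proof (rule partition_onI)
    show "\<Union> (cell ` space \<mu>) = space \<mu>" by (auto simp: cell_def)
    show "{} \<notin> cell ` space \<mu>" by (auto simp: cell_def)
    show "disjnt Y Z" if YZ: "Y \<in> cell ` space \<mu>" "Z \<in> cell ` space \<mu>" "Y \<noteq> Z" for Y Z
    proof (rule ccontr)
      assume "\<not> disjnt Y Z"
      then obtain z where z: "z \<in> Y" "z \<in> Z" by (auto simp: disjnt_def)
      obtain x y where "Y = cell x" "Z = cell y" using YZ by blast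
      with z have "\<forall>\<rho>\<in>F. c \<rho> x = c \<rho> y" by (auto simp: cell_def)
      then have "cell x = cell y" by (auto simp: cell_def)
      with \<open>Y = cell x\<close> \<open>Z = cell y\<close> \<open>Y \<noteq> Z\<close> show False by simp
    qed
  qed
  have "{y \<in> space \<mu>. c \<rho> y = c \<rho> x} \<in> sets \<mu>" if "\<rho> \<in> F" for \<rho> x
  proof -
    have [measurable]: "c \<rho> \<in> measurable \<mu> (count_space UNIV)" using that by (rule c)
    show ?thesis by measurable
  qed
  then have cell_sets: "cell x \<in> sets \<mu>" for x
    unfolding cell_def using F(1) by (intro sets.sets_Collect_finite_All) auto
  have A_sets: "(\<Union>\<rho>\<in>F. A \<rho>) \<in> sets \<mu>" using F(1) A(1) by (intro sets.finite_UN) auto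
  have A_less: "measure \<mu> (\<Union>\<rho>\<in>F. A \<rho>) < d"
  proof -
    have "measure \<mu> (\<Union>\<rho>\<in>F. A \<rho>) \<le> (\<Sum>\<rho>\<in>F. measure \<mu> (A \<rho>))"
      using F(1) A(1) by (intro finite_measure_subadditive_finite) auto
    also have "\<dots> \<le> (\<Sum>\<rho>\<in>F. d')" using A(2) by (intro sum_mono) (auto intro: less_imp_le)
    also have "\<dots> < d" using d by (simp add: d'_def field_simps)
    finally show ?thesis .
  qed
  have "\<rho> (x, y) \<le> e"
    if "\<rho> \<in> F" "x \<in> cell z - (\<Union>\<rho>\<in>F. A \<rho>)" "y \<in> cell z - (\<Union>\<rho>\<in>F. A \<rho>)" for \<rho> x y z
    using that by (intro close) (auto simp: cell_def)
  then have "\<forall>\<rho>\<in>F. \<forall>Y\<in>cell ` space \<mu>. \<forall>x\<in>Y - (\<Union>\<rho>\<in>F. A \<rho>). \<forall>y\<in>Y - (\<Union>\<rho>\<in>F. A \<rho>). \<rho> (x, y) \<le> e"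
    by blast
  moreover have "cell ` space \<mu> \<subseteq> sets \<mu>" using cell_sets by blast
  ultimately show ?thesis
    using fin_cells cells_partition A_sets A_less by (intro exI conjI)
qed

text \<open>
  Closeness in the m-norm only bounds \<open>\<rho>\<close> almost everywhere on a cell; routing through an
  intermediate point of the cell that is generic for both end points gives a bound everywhere.
\<close>

lemma uniformly_admissible_if_m_nets:
  assumes K: "\<And>\<rho>. \<rho> \<in> K \<Longrightarrow> admissible_semimetric \<mu> \<rho>"
    and nets: "\<And>e::real. 0 < e \<Longrightarrow>
      \<exists>F\<subseteq>K. finite F \<and> (\<forall>\<rho>\<in>K. \<exists>\<sigma>\<in>F. m_norm \<mu> (\<lambda>z. \<sigma> z - \<rho> z) < ennreal e)"
  shows "uniformly_admissible \<mu> K"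
  unfolding uniformly_admissible_def
proof (intro allI impI)
  fix \<epsilon> :: real assume \<epsilon>: "0 < \<epsilon>"
  \<comment> \<open>Distances will be bounded by \<open>6 * \<eta>\<close> and the exceptional
    measure by \<open>2 * \<eta>\<close>. A net of radius \<open>\<eta> * \<eta>\<close> is chosen
    because the Markov bound at level \<open>\<eta>\<close> then discards measure at most
    \<open>\<eta>\<close>.\<close>
  define \<eta> where "\<eta> = \<epsilon> / 8"
  have \<eta>: "0 < \<eta>" using \<epsilon> by (simp add: \<eta>_def)
  then obtain F where F: "F \<subseteq> K" "finite F"
    and net: "\<And>\<rho>. \<rho> \<in> K \<Longrightarrow> \<exists>\<sigma>\<in>F. m_norm \<mu> (\<lambda>z. \<sigma> z - \<rho> z) < ennreal (\<eta> * \<eta>)"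
    using nets[of "\<eta> * \<eta>"] by auto
  obtain P A where P: "finite P" "partition_on (space \<mu>) P" "P \<subseteq> sets \<mu>"
    and A: "A \<in> sets \<mu>" "measure \<mu> A < \<eta>"
    and small: "\<And>\<sigma> Y x y. \<sigma> \<in> F \<Longrightarrow> Y \<in> P \<Longrightarrow> x \<in> Y - A \<Longrightarrow> y \<in> Y - A \<Longrightarrow> \<sigma> (x, y) \<le> \<eta>"
    using ex_common_partition[OF F(2) _ \<eta> \<eta>] K F(1) by blast
  have "\<exists>B\<in>sets \<mu>. measure \<mu> B < \<epsilon> \<and> (\<forall>Y\<in>P. semimetric_diam \<rho> (Y - B) < ennreal \<epsilon>)"
    if \<rho>: "\<rho> \<in> K" for \<rho>
  proof -
    have \<rho>_summ: "summable_semimetric \<mu> \<rho>" using K[OF \<rho>] by (simp add: admissible_semimetric_def)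
    note semi = semimetric_onD[OF summable_semimetricD(1)[OF \<rho>_summ]]
    obtain \<sigma> where \<sigma>: "\<sigma> \<in> F" "m_norm \<mu> (\<lambda>z. \<sigma> z - \<rho> z) < ennreal (\<eta> * \<eta>)"
      using net[OF \<rho>] by blast
    from m_norm_lessE[OF \<sigma>(2)] obtain \<tau> where \<tau>: "summable_semimetric \<mu> \<tau>"
      and dom: "AE z in square \<mu>. \<bar>\<sigma> z - \<rho> z\<bar> \<le> \<tau> z"
      and int: "(\<integral>\<^sup>+ z. ennreal \<bar>\<tau> z\<bar> \<partial>square \<mu>) < ennreal (\<eta> * \<eta>)" .
    have "(\<integral>\<^sup>+ z. ennreal (\<tau> z) \<partial>square \<mu>) < ennreal (\<eta> * \<eta>)"
      by (rule order.strict_trans1[OF nn_integral_mono int]) (auto intro: ennreal_leI)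
    from semimetric_bounded_off[OF summable_semimetricD(1,3)[OF \<tau>] this \<eta>]
    obtain A' where A': "A' \<in> sets \<mu>" "measure \<mu> A' \<le> \<eta>"
      and \<tau>_small: "\<And>x y. x \<in> space \<mu> - A' \<Longrightarrow> y \<in> space \<mu> - A' \<Longrightarrow> \<tau> (x, y) \<le> 2 * \<eta>"
      using \<eta> by auto
    obtain N where N: "{x \<in> space \<mu>. \<not> (AE y in \<mu>. \<bar>\<sigma> (x, y) - \<rho> (x, y)\<bar> \<le> \<tau> (x, y))} \<subseteq> N"
      "emeasure \<mu> N = 0" "N \<in> sets \<mu>"
      using AE_square_D[OF dom] by (rule AE_E)
    \<comment> \<open>A cell that \<open>A\<close> and \<open>A'\<close> exhaust up to a null set
      offers no generic intermediate point; what is left of it is null and joins the exceptional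
      set.\<close>
    define Q where "Q = {Y \<in> P. emeasure \<mu> (Y - A - A') = 0}"
    define B where "B = (\<Union>Y\<in>Q. Y - A - A')"
    have Q: "finite Q" "\<And>Y. Y \<in> Q \<Longrightarrow> Y \<in> sets \<mu>" using P by (auto simp: Q_def)
    have "B \<in> null_sets \<mu>"
      unfolding B_def using Q(2) A(1) A'(1) Q_def
      by (intro null_sets_UN' countable_finite[OF Q(1)]) (auto simp: null_sets_def)
    then have NB: "N \<union> B \<in> null_sets \<mu>" using N by (intro null_sets.Un) auto
    let ?B = "(A \<union> A') \<union> (N \<union> B)"
    have "measure \<mu> ?B = measure \<mu> (A \<union> A')"
      using NB A A' by (intro measure_Un_null_set) auto
    also have "\<dots> \<le> measure \<mu> A + measure \<mu> A'"
      using A A' by (intro measure_Un_le) auto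
    also have "\<dots> < \<epsilon>" using A(2) A'(2) \<eta> by (simp add: \<eta>_def)
    finally have "measure \<mu> ?B < \<epsilon>" .
    moreover have "?B \<in> sets \<mu>" using NB A(1) A'(1) by auto
    moreover have "semimetric_diam \<rho> (Y - ?B) < ennreal \<epsilon>" if Y: "Y \<in> P" for Y
    proof -
      have Y_sets: "Y \<in> sets \<mu>" using Y P(3) by blast
      then have Y_space: "x \<in> Y \<Longrightarrow> x \<in> space \<mu>" for x using sets.sets_into_space by blast
      have "\<rho> (x, y) \<le> 6 * \<eta>" if xy: "x \<in> Y - ?B" "y \<in> Y - ?B" for x y
      proof -
        have "Y \<notin> Q" using xy by (auto simp: B_def)
        then have pos: "emeasure \<mu> (Y - A - A') \<noteq> 0" using Y by (simp add: Q_def)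
        have AE: "AE z in \<mu>. \<bar>\<sigma> (u, z) - \<rho> (u, z)\<bar> \<le> \<tau> (u, z)" if "u \<in> Y - ?B" for u
          using that N(1) Y_space by blast
        \<comment> \<open>The rest of the cell has positive measure, so it contains a point at which
          the domination holds from both \<open>x\<close> and \<open>y\<close>.\<close>
        have "\<not> (AE z in \<mu>. z \<notin> Y - A - A')"
          using pos Y_sets A(1) A'(1) by (auto simp: emeasure_eq_measure prob_eq_0)
        then obtain z where z: "z \<in> Y - A - A'"
          "\<bar>\<sigma> (x, z) - \<rho> (x, z)\<bar> \<le> \<tau> (x, z)" "\<bar>\<sigma> (y, z) - \<rho> (y, z)\<bar> \<le> \<tau> (y, z)"
          using AE_conjI[OF AE[OF xy(1)] AE[OF xy(2)]] by (metis (mono_tags, lifting) AE_mp AE_I2)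
        have "\<rho> (u, z) \<le> 3 * \<eta>" if "u \<in> Y - ?B" "\<bar>\<sigma> (u, z) - \<rho> (u, z)\<bar> \<le> \<tau> (u, z)" for u
        proof -
          have "\<sigma> (u, z) \<le> \<eta>" by (rule small[OF \<sigma>(1) Y]) (use that z(1) in auto)
          moreover have "\<tau> (u, z) \<le> 2 * \<eta>" by (rule \<tau>_small) (use that z(1) Y_space in auto)
          ultimately show ?thesis using that(2) by linarith
        qed
        from this[OF xy(1) z(2)] this[OF xy(2) z(3)]
        have "\<rho> (x, z) \<le> 3 * \<eta>" "\<rho> (y, z) \<le> 3 * \<eta>" .
        moreover have "\<rho> (x, y) \<le> \<rho> (x, z) + \<rho> (z, y)" by (rule semi(4)) (use xy z(1) Y_space in auto)
        moreover have "\<rho> (z, y) = \<rho> (y, z)" by (rule semi(3)) (use xy z(1) Y_space in auto)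
        ultimately show ?thesis by linarith
      qed
      then have "semimetric_diam \<rho> (Y - ?B) \<le> ennreal (6 * \<eta>)"
        unfolding semimetric_diam_def by (intro SUP_least) (auto intro!: ennreal_leI)
      also have "\<dots> < ennreal \<epsilon>" using \<epsilon> by (simp add: \<eta>_def ennreal_less_iff)
      finally show ?thesis .
    qed
    ultimately show ?thesis by blast
  qed
  with P show "\<exists>P. finite P \<and> partition_on (space \<mu>) P \<and> P \<subseteq> sets \<mu> \<and>
      (\<forall>\<rho>\<in>K. \<exists>A\<in>sets \<mu>. measure \<mu> A < \<epsilon> \<and> (\<forall>Y\<in>P. semimetric_diam \<rho> (Y - A) < ennreal \<epsilon>))"
    by blast
qed

end

section \<open>Finite nets from uniform integrability and uniform admissibility\<close>

lemma semimetric_quadrilateral: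
  assumes "semimetric_on X \<rho>" "x \<in> X" "y \<in> X" "u \<in> X" "v \<in> X"
  shows "\<bar>\<rho> (x, y) - \<rho> (u, v)\<bar> \<le> \<rho> (x, u) + \<rho> (y, v)"
proof -
  note semi = semimetric_onD[OF assms(1)]
  have "\<rho> (x, y) \<le> \<rho> (x, u) + \<rho> (u, y)" "\<rho> (u, y) \<le> \<rho> (u, v) + \<rho> (v, y)"
    "\<rho> (u, v) \<le> \<rho> (u, x) + \<rho> (x, v)" "\<rho> (x, v) \<le> \<rho> (x, y) + \<rho> (y, v)"
    "\<rho> (u, x) = \<rho> (x, u)" "\<rho> (v, y) = \<rho> (y, v)"
    using assms(2-) by (auto intro!: semi(3,4))
  then show ?thesis by linarith
qed

text \<open>On \<open>S\<close> the function is split at level \<open>R\<close>: the lower part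
  contributes at most \<open>R\<close> per unit of measure, the upper part at most the tail. For a
  uniformly integrable family this gives absolute continuity of the integrals, uniformly in the
  family.\<close>

lemma nn_integral_small_set:
  assumes f: "f \<in> borel_measurable N" and S: "S \<in> sets N"
    and tail: "(\<integral>\<^sup>+ z. ennreal \<bar>f z\<bar> * indicator {z. R < \<bar>f z\<bar>} z \<partial>N) \<le> t"
  shows "(\<integral>\<^sup>+ z. ennreal \<bar>f z\<bar> * indicator S z \<partial>N) \<le> ennreal R * emeasure N S + t"
proof -
  note [measurable] = f S
  have "(\<integral>\<^sup>+ z. ennreal \<bar>f z\<bar> * indicator S z \<partial>N)
      \<le> (\<integral>\<^sup>+ z. ennreal R * indicator S z + ennreal \<bar>f z\<bar> * indicator {z. R < \<bar>f z\<bar>} z \<partial>N)"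
    by (intro nn_integral_mono) (auto simp: indicator_def intro: ennreal_leI)
  also have "\<dots> = ennreal R * emeasure N S
      + (\<integral>\<^sup>+ z. ennreal \<bar>f z\<bar> * indicator {z. R < \<bar>f z\<bar>} z \<partial>N)"
    by (subst nn_integral_add) (auto simp: nn_integral_cmult_indicator)
  finally show ?thesis using tail by (meson add_left_mono order.trans)
qed

context complete_prob_space
begin

text \<open>
  Moving the points of the small set \<open>E\<close> to a point \<open>p\<close> outside \<open>E\<close> changes each of the two
  semimetrics by at most its distance to \<open>p\<close>; a typical \<open>p\<close> makes the integral of that distance
  over \<open>E\<close> small.
\<close>

lemma m_norm_diff_semimetrics:
  assumes diag: "{z \<in> space \<mu> \<times> space \<mu>. fst z = snd z} \<in> sets (square \<mu>)"
    and \<rho>: "summable_semimetric \<mu> \<rho>" and \<sigma>: "summable_semimetric \<mu> \<sigma>"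
    and E: "E \<in> sets \<mu>" "measure \<mu> E \<le> 1/2"
    and int: "(\<integral>\<^sup>+ z. ennreal (\<rho> z + \<sigma> z) * indicator E (snd z) \<partial>square \<mu>) < ennreal (H/2)"
    and H: "0 < H" and c: "0 \<le> c"
    and close: "\<And>x y. x \<in> space \<mu> - E \<Longrightarrow> y \<in> space \<mu> - E \<Longrightarrow> \<bar>\<rho> (x, y) - \<sigma> (x, y)\<bar> \<le> c"
  shows "m_norm \<mu> (\<lambda>z. \<rho> z - \<sigma> z) \<le> ennreal (2 * H + c)"
proof -
  note [measurable] = summable_semimetricD(3)[OF \<rho>] summable_semimetricD(3)[OF \<sigma>] E(1)
  note semi_\<rho> = summable_semimetricD(1)[OF \<rho>] and semi_\<sigma> = summable_semimetricD(1)[OF \<sigma>]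
  let ?f = "\<lambda>z. (\<rho> z + \<sigma> z) * indicator E (snd z) :: real"
  have meas: "?f \<in> borel_measurable (square \<mu>)" by measurable
  have "(\<integral>\<^sup>+ x. (\<integral>\<^sup>+ y. ennreal (?f (x, y)) \<partial>\<mu>) * indicator (space \<mu> - E) x \<partial>\<mu>)
      \<le> (\<integral>\<^sup>+ x. \<integral>\<^sup>+ y. ennreal (?f (x, y)) \<partial>\<mu> \<partial>\<mu>)"
    by (intro nn_integral_mono) (auto simp: indicator_def)
  also have "\<dots> = (\<integral>\<^sup>+ z. ennreal (?f z) \<partial>square \<mu>)"
    by (intro nn_integral_square) measurable
  also have "\<dots> = (\<integral>\<^sup>+ z. ennreal (\<rho> z + \<sigma> z) * indicator E (snd z) \<partial>square \<mu>)"
    by (intro nn_integral_cong) (auto simp: indicator_def)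
  also have "\<dots> < ennreal (H/2)" by (rule int)
  \<comment> \<open>The complement of \<open>E\<close> has measure at least one half, so an integral
    below \<open>H/2\<close> becomes an average below \<open>H\<close> there.\<close>
  also have "\<dots> \<le> ennreal H * emeasure \<mu> (space \<mu> - E)"
  proof -
    have "measure \<mu> (space \<mu> - E) = 1 - measure \<mu> E" using E(1) by (rule prob_compl)
    then have "H * (1/2) \<le> H * measure \<mu> (space \<mu> - E)" using H E(2) by (intro mult_left_mono) auto
    then show ?thesis using H by (simp add: emeasure_eq_measure ennreal_leI flip: ennreal_mult)
  qed
  finally have less: "(\<integral>\<^sup>+ x. (\<integral>\<^sup>+ y. ennreal (?f (x, y)) \<partial>\<mu>) * indicator (space \<mu> - E) x \<partial>\<mu>)
      < ennreal H * emeasure \<mu> (space \<mu> - E)" .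
  have "space \<mu> - E \<in> sets \<mu>" by measurable
  from ex_AE_less_average[OF borel_measurable_section[OF meas] this less] obtain p where p: "p \<in> space \<mu> - E"
    and h_meas: "(\<lambda>y. ?f (p, y)) \<in> borel_measurable \<mu>"
    and h_int: "(\<integral>\<^sup>+ y. ennreal (?f (p, y)) \<partial>\<mu>) < ennreal H"
    by (elim bexE conjE)
  define h where "h x = ?f (p, x)" for x
  show ?thesis
  proof (rule m_norm_le_sum[OF diag, where h = h])
    show "h \<in> borel_measurable \<mu>" using h_meas by (simp add: h_def[abs_def])
    show "0 \<le> h x" if "x \<in> space \<mu>" for x
      using that p semimetric_onD(1)[OF semi_\<rho>] semimetric_onD(1)[OF semi_\<sigma>] by (simp add: h_def)
    show "(\<integral>\<^sup>+ x. ennreal (h x) \<partial>\<mu>) \<le> ennreal H" using h_int by (simp add: h_def)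
    show "\<rho> (x, x) - \<sigma> (x, x) = 0" if "x \<in> space \<mu>" for x
      using that semimetric_onD(2)[OF semi_\<rho>] semimetric_onD(2)[OF semi_\<sigma>] by simp
    fix x y assume xy: "x \<in> space \<mu>" "y \<in> space \<mu>"
    \<comment> \<open>The retraction sends \<open>E\<close> to \<open>p\<close> and fixes all other
      points; \<open>h\<close> is the displacement under it, summed over the two
      semimetrics.\<close>
    define r where "r u = (if u \<in> E then p else u)" for u
    have r: "r u \<in> space \<mu> - E" if "u \<in> space \<mu>" for u using that p by (simp add: r_def)
    have rh: "\<rho> (u, r u) + \<sigma> (u, r u) = h u" if "u \<in> space \<mu>" for u
      using that p semimetric_onD(2,3)[OF semi_\<rho>] semimetric_onD(2,3)[OF semi_\<sigma>]
      by (simp add: r_def h_def)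
    have "\<bar>\<rho> (x, y) - \<rho> (r x, r y)\<bar> \<le> \<rho> (x, r x) + \<rho> (y, r y)"
      using semimetric_quadrilateral[OF semi_\<rho>] xy r by blast
    moreover have "\<bar>\<sigma> (x, y) - \<sigma> (r x, r y)\<bar> \<le> \<sigma> (x, r x) + \<sigma> (y, r y)"
      using semimetric_quadrilateral[OF semi_\<sigma>] xy r by blast
    moreover have "\<bar>\<rho> (r x, r y) - \<sigma> (r x, r y)\<bar> \<le> c"
      using close r xy by blast
    ultimately show "\<bar>\<rho> (x, y) - \<sigma> (x, y)\<bar> \<le> h x + h y + c"
      using rh[OF xy(1)] rh[OF xy(2)] by linarith
  qed (use H c in auto)
qed

text \<open>
  Two members of \<open>K\<close> are close in m-norm once their rounded distance matrices between
  representatives of the cells agree.  Only finitely many such matrices occur, since outside a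
  small set all members of \<open>K\<close> obey a common bound.
\<close>

lemma ex_m_net:
  assumes diag: "{z \<in> space \<mu> \<times> space \<mu>. fst z = snd z} \<in> sets (square \<mu>)"
    and K: "\<And>\<rho>. \<rho> \<in> K \<Longrightarrow> summable_semimetric \<mu> \<rho>"
    and ui: "uniformly_integrable (square \<mu>) K" and ua: "uniformly_admissible \<mu> K" and e: "0 < e"
  shows "\<exists>F\<subseteq>K. finite F \<and> (\<forall>\<rho>\<in>K. \<exists>\<sigma>\<in>F. m_norm \<mu> (\<lambda>z. \<sigma> z - \<rho> z) < ennreal e)"
proof -
  \<comment> \<open>The final bound is \<open>2 * (9 * t) + 5 * \<epsilon>\<close>, at most
    \<open>23 * t\<close> and hence below \<open>e\<close>.\<close>
  define t where "t = e / 24"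
  have t: "0 < t" using e by (simp add: t_def)
  from ui[unfolded uniformly_integrable_iff, rule_format, OF t]
  obtain R where R: "0 \<le> R" and tail_all: "\<forall>\<rho>\<in>K.
      (\<integral>\<^sup>+ z. ennreal \<bar>\<rho> z\<bar> * indicator {z. R < \<bar>\<rho> z\<bar>} z \<partial>square \<mu>) \<le> ennreal t"
    by (elim exE conjE)
  note tail = bspec[OF tail_all]
  \<comment> \<open>Exceptional sets of two members together have measure at most
    \<open>4 * \<epsilon>\<close>. The first bound keeps this below one half, the third makes
    \<open>R * (4 * \<epsilon>)\<close> at most \<open>t\<close>, and the second serves the final
    estimate.\<close>
  define \<epsilon> where "\<epsilon> = min (1/8) (min t (t / (4 * (R + 1))))"
  have \<epsilon>_le: "\<epsilon> \<le> 1/8" "\<epsilon> \<le> t" "\<epsilon> \<le> t / (4 * (R + 1))"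
    unfolding \<epsilon>_def by (rule min.cobounded1, (rule min.coboundedI2, simp)+)
  have "0 < \<epsilon>" using t R by (simp add: \<epsilon>_def)
  note \<epsilon> = this \<epsilon>_le(1,2)
  have "\<epsilon> * (4 * (R + 1)) \<le> t"
    using R \<epsilon>_le(3) by (subst pos_le_divide_eq[symmetric]) auto
  then have R\<epsilon>: "R * (4 * \<epsilon>) \<le> t" using \<epsilon>(1) by (simp add: algebra_simps)
  \<comment> \<open>\<open>C\<close> exceeds every integral over the whole square, and
    \<open>L\<close> is the level at which the Markov bound discards measure at most
    \<open>\<epsilon>\<close>.\<close>
  define C where "C = R + t + 1"
  define L where "L = C / \<epsilon>"
  have L: "0 < L" "C / L = \<epsilon>" using R t \<epsilon>(1) by (auto simp: C_def L_def)
  from ua[unfolded uniformly_admissible_def, rule_format, OF \<epsilon>(1)]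
  obtain P where P: "finite P" "partition_on (space \<mu>) P"
    and P_small: "\<forall>\<rho>\<in>K. \<exists>A\<in>sets \<mu>. measure \<mu> A < \<epsilon> \<and>
      (\<forall>Y\<in>P. semimetric_diam \<rho> (Y - A) < ennreal \<epsilon>)"
    by (elim exE conjE)
  have P_space: "Y \<in> P \<Longrightarrow> x \<in> Y \<Longrightarrow> x \<in> space \<mu>" for x Y
    using partition_onD1[OF P(2)] by blast
  have "\<forall>\<rho>\<in>K. \<exists>A. A \<in> sets \<mu> \<and> measure \<mu> A < 2 * \<epsilon> \<and>
      (\<forall>Y\<in>P. \<forall>x\<in>Y - A. \<forall>y\<in>Y - A. \<rho> (x, y) \<le> \<epsilon>) \<and>
      (\<forall>x\<in>space \<mu> - A. \<forall>y\<in>space \<mu> - A. \<rho> (x, y) \<le> 2 * L)"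
  proof
    fix \<rho> assume \<rho>: "\<rho> \<in> K"
    obtain A where A: "A \<in> sets \<mu>" "measure \<mu> A < \<epsilon>"
      and diam: "\<And>Y. Y \<in> P \<Longrightarrow> semimetric_diam \<rho> (Y - A) < ennreal \<epsilon>" using bspec[OF P_small \<rho>] by blast
    have "(\<integral>\<^sup>+ z. ennreal (\<rho> z) \<partial>square \<mu>)
        \<le> (\<integral>\<^sup>+ z. ennreal \<bar>\<rho> z\<bar> * indicator (space (square \<mu>)) z \<partial>square \<mu>)"
      by (intro nn_integral_mono) (auto intro: ennreal_leI)
    also have "\<dots> \<le> ennreal R * emeasure (square \<mu>) (space (square \<mu>)) + ennreal t"
      by (rule nn_integral_small_set[OF summable_semimetricD(3)[OF K[OF \<rho>]] sets.top tail[OF \<rho>]])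
    also have "\<dots> < ennreal C"
      unfolding emeasure_square_space using R t
      by (simp add: C_def ennreal_less_iff flip: ennreal_plus)
    finally have int: "(\<integral>\<^sup>+ z. ennreal (\<rho> z) \<partial>square \<mu>) < ennreal C" .
    obtain A' where A': "A' \<in> sets \<mu>" "measure \<mu> A' \<le> \<epsilon>"
      "\<And>x y. x \<in> space \<mu> - A' \<Longrightarrow> y \<in> space \<mu> - A' \<Longrightarrow> \<rho> (x, y) \<le> 2 * L"
      using semimetric_bounded_off[OF summable_semimetricD(1,3)[OF K[OF \<rho>]] int L(1)]
      unfolding L(2) by blast
    have "\<rho> (x, y) \<le> \<epsilon>" if "Y \<in> P" "x \<in> Y - (A \<union> A')" "y \<in> Y - (A \<union> A')" for Y x y
    proof -
      have "ennreal (\<rho> (x, y)) \<le> semimetric_diam \<rho> (Y - A)"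
        unfolding semimetric_diam_def using that by (intro SUP_upper) auto
      also have "\<dots> < ennreal \<epsilon>" using that(1) by (rule diam)
      finally have "\<not> ennreal \<epsilon> \<le> ennreal (\<rho> (x, y))" by simp
      then show ?thesis using ennreal_leI linear by blast
    qed
    moreover have "measure \<mu> (A \<union> A') < 2 * \<epsilon>"
      using measure_Un_le[OF A(1) A'(1)] A(2) A'(2) by linarith
    ultimately show "\<exists>A. A \<in> sets \<mu> \<and> measure \<mu> A < 2 * \<epsilon> \<and>
      (\<forall>Y\<in>P. \<forall>x\<in>Y - A. \<forall>y\<in>Y - A. \<rho> (x, y) \<le> \<epsilon>) \<and>
      (\<forall>x\<in>space \<mu> - A. \<forall>y\<in>space \<mu> - A. \<rho> (x, y) \<le> 2 * L)"
      using A(1) A' by (intro exI[of _ "A \<union> A'"]) auto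
  qed
  from bchoice[OF this] obtain A where A': "\<forall>\<rho>\<in>K. A \<rho> \<in> sets \<mu> \<and> measure \<mu> (A \<rho>) < 2 * \<epsilon> \<and>
      (\<forall>Y\<in>P. \<forall>x\<in>Y - A \<rho>. \<forall>y\<in>Y - A \<rho>. \<rho> (x, y) \<le> \<epsilon>) \<and>
      (\<forall>x\<in>space \<mu> - A \<rho>. \<forall>y\<in>space \<mu> - A \<rho>. \<rho> (x, y) \<le> 2 * L)" by (elim exE)
  then have A: "A \<rho> \<in> sets \<mu>" "measure \<mu> (A \<rho>) < 2 * \<epsilon>"
    and cell: "\<And>Y x y. Y \<in> P \<Longrightarrow> x \<in> Y - A \<rho> \<Longrightarrow> y \<in> Y - A \<rho> \<Longrightarrow> \<rho> (x, y) \<le> \<epsilon>"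
    and bound: "\<And>x y. x \<in> space \<mu> - A \<rho> \<Longrightarrow> y \<in> space \<mu> - A \<rho> \<Longrightarrow> \<rho> (x, y) \<le> 2 * L"
    if "\<rho> \<in> K" for \<rho> using that by blast+
  define pt where "pt \<rho> Y = (SOME x. x \<in> Y - A \<rho>)" for \<rho> Y
  have pt: "pt \<rho> Y \<in> Y - A \<rho>" if "x \<in> Y - A \<rho>" for \<rho> Y x
    unfolding pt_def using that by (rule someI)
  \<comment> \<open>A cell swallowed by the exceptional set has no representative; its entry is set
    to 0, which lies in the range of codes and is never consulted off the exceptional sets.\<close>
  define entry where "entry \<rho> = (\<lambda>(Y, Z). if Y - A \<rho> = {} \<or> Z - A \<rho> = {} then 0
      else \<lfloor>\<rho> (pt \<rho> Y, pt \<rho> Z) / \<epsilon>\<rfloor>)" for \<rho>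
  define code where "code \<rho> = restrict (entry \<rho>) (P \<times> P)" for \<rho>
  have "code \<rho> \<in> PiE (P \<times> P) (\<lambda>_. {0..\<lfloor>2 * L / \<epsilon>\<rfloor>})" if \<rho>: "\<rho> \<in> K" for \<rho>
    unfolding code_def
  proof (intro restrict_PiE_iff[THEN iffD2] ballI)
    fix q assume "q \<in> P \<times> P"
    then obtain Y Z where q: "q = (Y, Z)" "Y \<in> P" "Z \<in> P" by blast
    show "entry \<rho> q \<in> {0..\<lfloor>2 * L / \<epsilon>\<rfloor>}"
    proof (cases "Y - A \<rho> = {} \<or> Z - A \<rho> = {}")
      case True
      then show ?thesis using L(1) \<epsilon>(1) by (auto simp: entry_def q)
    next
      case False
      then have "pt \<rho> Y \<in> Y - A \<rho>" "pt \<rho> Z \<in> Z - A \<rho>" using pt by blast+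
      then have sp: "pt \<rho> Y \<in> space \<mu> - A \<rho>" "pt \<rho> Z \<in> space \<mu> - A \<rho>" using q P_space by blast+
      have "0 \<le> \<rho> (pt \<rho> Y, pt \<rho> Z)"
        using sp by (intro semimetric_onD(1)[OF summable_semimetricD(1)[OF K[OF \<rho>]]]) auto
      moreover have "\<rho> (pt \<rho> Y, pt \<rho> Z) \<le> 2 * L" using sp by (rule bound[OF \<rho>])
      ultimately show ?thesis
        using False \<epsilon>(1) by (auto simp: entry_def q intro!: floor_mono divide_right_mono)
    qed
  qed
  then have "code ` K \<subseteq> PiE (P \<times> P) (\<lambda>_. {0..\<lfloor>2 * L / \<epsilon>\<rfloor>})" by blast
  then have "finite (code ` K)"
    by (rule finite_subset) (intro finite_PiE finite_cartesian_product P(1) finite_atLeastAtMost_int)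
  from finite_subset_image[OF this subset_refl] obtain F
    where F: "F \<subseteq> K" "finite F" "code ` K = code ` F" by (elim exE conjE)
  have "\<exists>\<sigma>\<in>F. m_norm \<mu> (\<lambda>z. \<sigma> z - \<rho> z) < ennreal e" if \<rho>: "\<rho> \<in> K" for \<rho>
  proof -
    have "code \<rho> \<in> code ` F" using \<rho> F(3) by blast
    then obtain \<sigma> where "\<sigma> \<in> F" and same: "code \<sigma> = code \<rho>" by force
    then have \<sigma>: "\<sigma> \<in> K" using F(1) by blast
    let ?E = "A \<sigma> \<union> A \<rho>"
    have E: "?E \<in> sets \<mu>" using A \<rho> \<sigma> by auto
    have E_less: "measure \<mu> ?E \<le> 4 * \<epsilon>"
      using measure_Un_le[OF A(1)[OF \<sigma>] A(1)[OF \<rho>]] A(2)[OF \<sigma>] A(2)[OF \<rho>] by linarith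
    \<comment> \<open>Moving to the representatives costs \<open>2 * \<epsilon>\<close> in each
      semimetric, and equal rounded entries differ by at most \<open>\<epsilon>\<close> before
      rounding.\<close>
    have close: "\<bar>\<sigma> (x, y) - \<rho> (x, y)\<bar> \<le> 5 * \<epsilon>" if x: "x \<in> space \<mu> - ?E" and y: "y \<in> space \<mu> - ?E" for x y
    proof -
      obtain Y Z where YZ: "Y \<in> P" "Z \<in> P" "x \<in> Y" "y \<in> Z"
        using x y partition_onD1[OF P(2)] by blast
      have near: "\<bar>\<tau> (x, y) - \<tau> (pt \<tau> Y, pt \<tau> Z)\<bar> \<le> 2 * \<epsilon>" "entry \<tau> (Y, Z) = \<lfloor>\<tau> (pt \<tau> Y, pt \<tau> Z) / \<epsilon>\<rfloor>"
        if \<tau>: "\<tau> \<in> K" "x \<notin> A \<tau>" "y \<notin> A \<tau>" for \<tau>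
      proof -
        have xy: "x \<in> Y - A \<tau>" "y \<in> Z - A \<tau>" using \<tau> YZ by auto
        then have p: "pt \<tau> Y \<in> Y - A \<tau>" "pt \<tau> Z \<in> Z - A \<tau>" using pt by blast+
        have "\<bar>\<tau> (x, y) - \<tau> (pt \<tau> Y, pt \<tau> Z)\<bar> \<le> \<tau> (x, pt \<tau> Y) + \<tau> (y, pt \<tau> Z)"
          using p x y YZ P_space
          by (intro semimetric_quadrilateral[OF summable_semimetricD(1)[OF K[OF \<tau>(1)]]]) auto
        moreover have "\<tau> (x, pt \<tau> Y) \<le> \<epsilon>" "\<tau> (y, pt \<tau> Z) \<le> \<epsilon>"
          using cell[OF \<tau>(1) YZ(1) xy(1) p(1)] cell[OF \<tau>(1) YZ(2) xy(2) p(2)] by auto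
        ultimately show "\<bar>\<tau> (x, y) - \<tau> (pt \<tau> Y, pt \<tau> Z)\<bar> \<le> 2 * \<epsilon>" by linarith
        show "entry \<tau> (Y, Z) = \<lfloor>\<tau> (pt \<tau> Y, pt \<tau> Z) / \<epsilon>\<rfloor>" using xy by (auto simp: entry_def)
      qed
      have "entry \<sigma> (Y, Z) = entry \<rho> (Y, Z)"
        using fun_cong[OF same, of "(Y, Z)"] YZ by (simp add: code_def)
      then have "\<lfloor>\<sigma> (pt \<sigma> Y, pt \<sigma> Z) / \<epsilon>\<rfloor> = \<lfloor>\<rho> (pt \<rho> Y, pt \<rho> Z) / \<epsilon>\<rfloor>"
        using near(2)[OF \<sigma>] near(2)[OF \<rho>] x y by simp
      then have "\<bar>\<sigma> (pt \<sigma> Y, pt \<sigma> Z) / \<epsilon> - \<rho> (pt \<rho> Y, pt \<rho> Z) / \<epsilon>\<bar> \<le> 1" by linarith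
      then have "\<bar>\<sigma> (pt \<sigma> Y, pt \<sigma> Z) - \<rho> (pt \<rho> Y, pt \<rho> Z)\<bar> \<le> \<epsilon>"
        using \<epsilon>(1) by (simp flip: diff_divide_distrib)
      then show ?thesis using near(1)[OF \<sigma>] near(1)[OF \<rho>] x y by fastforce
    qed
    have part: "(\<integral>\<^sup>+ z. ennreal \<bar>\<tau> z\<bar> * indicator (space \<mu> \<times> ?E) z \<partial>square \<mu>) \<le> ennreal (2 * t)"
      if \<tau>: "\<tau> \<in> K" for \<tau>
    proof -
      have "(\<integral>\<^sup>+ z. ennreal \<bar>\<tau> z\<bar> * indicator (space \<mu> \<times> ?E) z \<partial>square \<mu>)
          \<le> ennreal R * emeasure (square \<mu>) (space \<mu> \<times> ?E) + ennreal t"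
        using E by (intro nn_integral_small_set[OF summable_semimetricD(3)[OF K[OF \<tau>]] _ tail[OF \<tau>]]) auto
      also have "emeasure (square \<mu>) (space \<mu> \<times> ?E) = ennreal (measure \<mu> ?E)"
        using E by (simp add: emeasure_pair_measure_Times emeasure_eq_measure prob_space)
      also have "ennreal R * ennreal (measure \<mu> ?E) + ennreal t = ennreal (R * measure \<mu> ?E + t)"
        using R t by (simp add: ennreal_mult)
      also have "\<dots> \<le> ennreal (2 * t)"
        using mult_left_mono[OF E_less R] R\<epsilon> by (intro ennreal_leI) linarith
      finally show ?thesis .
    qed
    note [measurable] = summable_semimetricD(3)[OF K[OF \<sigma>]] summable_semimetricD(3)[OF K[OF \<rho>]] E
    have "(\<integral>\<^sup>+ z. ennreal (\<sigma> z + \<rho> z) * indicator ?E (snd z) \<partial>square \<mu>)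
      \<le> (\<integral>\<^sup>+ z. ennreal \<bar>\<sigma> z\<bar> * indicator (space \<mu> \<times> ?E) z
            + ennreal \<bar>\<rho> z\<bar> * indicator (space \<mu> \<times> ?E) z \<partial>square \<mu>)"
      by (intro nn_integral_mono)
        (auto simp: indicator_def space_pair_measure simp flip: ennreal_plus intro!: ennreal_leI)
    also have "\<dots> = (\<integral>\<^sup>+ z. ennreal \<bar>\<sigma> z\<bar> * indicator (space \<mu> \<times> ?E) z \<partial>square \<mu>)
        + (\<integral>\<^sup>+ z. ennreal \<bar>\<rho> z\<bar> * indicator (space \<mu> \<times> ?E) z \<partial>square \<mu>)"
      using E by (intro nn_integral_add borel_measurable_times_ennreal borel_measurable_indicator) auto
    also have "\<dots> \<le> ennreal (2 * t) + ennreal (2 * t)" using part[OF \<sigma>] part[OF \<rho>] by (rule add_mono)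
    \<comment> \<open>The two parts sum to \<open>4 * t\<close>; taking \<open>H = 9 * t\<close>
      makes \<open>H/2\<close> strictly larger, as the comparison lemma requires.\<close>
    also have "\<dots> < ennreal ((9 * t) / 2)" using t by (simp add: ennreal_less_iff flip: ennreal_plus)
    finally have int: "(\<integral>\<^sup>+ z. ennreal (\<sigma> z + \<rho> z) * indicator ?E (snd z) \<partial>square \<mu>) < ennreal ((9 * t) / 2)" .
    have "m_norm \<mu> (\<lambda>z. \<sigma> z - \<rho> z) \<le> ennreal (2 * (9 * t) + 5 * \<epsilon>)"
      by (rule m_norm_diff_semimetrics[OF diag K[OF \<sigma>] K[OF \<rho>] E _ int _ _ close])
        (use E_less \<epsilon> t in auto)
    also have "\<dots> < ennreal e" using \<epsilon>(1,3) e by (intro ennreal_lessI) (auto simp: t_def)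
    finally show ?thesis using \<open>\<sigma> \<in> F\<close> by blast
  qed
  with F(1,2) show ?thesis by blast
qed

end

theorem theorem5:
  fixes \<mu> :: "'a measure" and M :: "('a \<times> 'a \<Rightarrow> real) set"
  assumes "lebesgue_prob_space \<mu>"
    and "\<And>\<rho>. \<rho> \<in> M \<Longrightarrow> admissible_semimetric \<mu> \<rho>"
  shows "m_precompact \<mu> M \<longleftrightarrow>
           uniformly_integrable (square \<mu>) M \<and> uniformly_admissible \<mu> M"
proof -
  from assms(1) interpret complete_prob_space \<mu>
    by (simp add: lebesgue_prob_space_def complete_prob_space_def)
  have summ: "summable_semimetric \<mu> \<rho>" if "\<rho> \<in> M" for \<rho>
    using assms(2)[OF that] by (simp add: admissible_semimetric_def)
  let ?nets = "\<forall>e>0. \<exists>F\<subseteq>M. finite F \<and>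
    (\<forall>\<rho>\<in>M. \<exists>\<sigma>\<in>F. m_norm \<mu> (\<lambda>z. \<sigma> z - \<rho> z) < ennreal e)"
  have "?nets \<longleftrightarrow> uniformly_integrable (square \<mu>) M \<and> uniformly_admissible \<mu> M"
  proof (intro iffI conjI)
    assume ?nets
    note nets = this[rule_format]
    show "uniformly_integrable (square \<mu>) M"
      by (rule uniformly_integrable_if_m_nets[OF summable_semimetricD(2)[OF summ] nets])
    show "uniformly_admissible \<mu> M"
      by (rule uniformly_admissible_if_m_nets[OF assms(2) nets])
  next
    assume "uniformly_integrable (square \<mu>) M \<and> uniformly_admissible \<mu> M"
    then have ui: "uniformly_integrable (square \<mu>) M" and ua: "uniformly_admissible \<mu> M" by auto
    show ?nets
      by (intro allI impI ex_m_net[OF measurable_diagonal_square[OF assms(1)] summ ui ua])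
  qed
  with m_precompact_iff[OF summ] show ?thesis by (rule trans)
qed
end
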